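(* Let $\Phi$ be a root system of type $D_\ell$ with $\ell\ge4$ even, $j\in\{\ell-1,\ell\}$ and $\omega=\omega_j$. Then the set $\Phi_{\omega,0}^+=\{\beta\in\Phi^+:\beta^\omega=0\}$ is $$\Phi_{\omega,0}^+=\begin{cases}\{e_1-e_\ell\}\sqcup\{e_i+e_{\ell-i+1}: i\in\{2,\dots,\tfrac\ell2\}\} & \text{if } j=\ell-1,\\ \{e_i+e_{\ell-i+1}: i\in\{1,\dots,\tfrac\ell2\}\} & \text{if } j=\ell,\end{cases}$$ and, in both cases, $$\Phi_{\omega,0}^+=\{\alpha_1+\cdots+\alpha_{\ell-2}+\alpha_j\}\sqcup\{\alpha_{i_1}+\cdots+\alpha_{\ell-i_1}+2\alpha_{\ell-i_1+1}+\cdots+2\alpha_{\ell-2}+\alpha_{\ell-1}+\alpha_\ell: i_1\in\{2,\dots,\tfrac\ell2\}\}.$$ Hence $P(0)=\{\pm1\}$.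
   Context: Realize $\Phi$ of type $D_\ell$ in $E=\mathbb{R}^\ell$ with standard basis $e_1,\dots,e_\ell$ as $\{\pm e_p\pm e_q:p<q\}$, with basis $\Delta$: $\alpha_i=e_i-e_{i+1}$ ($1\le i\le\ell-1$), $\alpha_\ell=e_{\ell-1}+e_\ell$; $\Phi^+$ is the corresponding set of positive roots. Empty ranges in sums of simple roots contribute $0$. Let $\tilde\alpha=\sum_{i=1}^\ell n_i\alpha_i$ be the highest root, $\alpha_0=-\tilde\alpha$, $n_0=1$; then $J=\{i\in\{0,\dots,\ell\}:n_i=1\}=\{0,1,\ell-1,\ell\}$. For $j\in\{\ell-1,\ell\}$ let $w_j$ be the longest element of the subgroup of the Weyl group $W$ generated by the $s_{\alpha_i}$, $i\in\{1,\dots,\ell\}\setminus\{j\}$, let $w_0$ be the longest element of $W$, and $\omega_j=w_jw_0$; it acts on $\{\alpha_0,\dots,\alpha_\ell\}$ by an index permutation $\sigma_j$, where for $\ell$ even $\sigma_\ell=(0\ \ell)(1\ \ \ell-1)\prod_{i=2}^{\ell/2-1}(i\ \ \ell-i)$ and $\sigma_{\ell-1}=(0\ \ \ell-1)(1\ \ell)\prod_{i=2}^{\ell/2-1}(i\ \ \ell-i)$. Put $x^\omega=\frac1{o(\omega)}\sum_{t=1}^{o(\omega)}\omega^t(x)$ with $o(\omega)=2$ the order of $\omega=\omega_j$. Let $\varpi_1^\vee,\dots,\varpi_\ell^\vee$ be the dual basis of $\Delta$, $\varpi_0^\vee=0$, and $\pi_0^j=\varpi_0^\vee+\varpi_j^\vee$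 the sum over the $\langle\sigma_j\rangle$-orbit of $0$. Put $P(0)=\{(\gamma,\pi_0^j):\gamma\in\Phi,\ \gamma^\omega=0\}$. *)

theory Defs
  imports "HOL-Analysis.Analysis"
begin

text \<open>
  Everything takes place in the Euclidean space \<open>real ^ 'n\<close>. The definitions take as parameters its
  dimension \<open>l\<close> and an enumeration \<open>e 1, \<dots>, e l\<close> of its standard basis (\<open>Basis\<close>); the values of \<open>e\<close>
  outside \<open>{1..l}\<close> are irrelevant.
\<close>

definition roots :: "(nat \<Rightarrow> real ^ 'n) \<Rightarrow> nat \<Rightarrow> (real ^ 'n) set" where
  "roots e l = {s *\<^sub>R e p + t *\<^sub>R e q | s t p q.
     s \<in> {1, - 1} \<and> t \<in> {1, - 1} \<and> 1 \<le> p \<and> p < q \<and> q \<le> l}"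

text \<open>The simple roots \<open>\<alpha>\<^sub>1, \<dots>, \<alpha>\<^sub>l\<close>; only indices in \<open>{1..l}\<close> are meaningful.\<close>

definition simple_root :: "(nat \<Rightarrow> real ^ 'n) \<Rightarrow> nat \<Rightarrow> nat \<Rightarrow> real ^ 'n" where
  "simple_root e l i = (if i = l then e (l - 1) + e l else e i - e (i + 1))"

definition pos_roots :: "(nat \<Rightarrow> real ^ 'n) \<Rightarrow> nat \<Rightarrow> (real ^ 'n) set" where
  "pos_roots e l =
     {\<beta> \<in> roots e l. \<exists>c :: nat \<Rightarrow> nat. \<beta> = (\<Sum>i = 1..l. real (c i) *\<^sub>R simple_root e l i)}"

definition highest_root :: "(nat \<Rightarrow> real ^ 'n) \<Rightarrow> nat \<Rightarrow> real ^ 'n" where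
  "highest_root e l = (THE \<beta>. \<beta> \<in> roots e l \<and>
     (\<forall>\<gamma> \<in> roots e l. \<exists>c :: nat \<Rightarrow> nat. \<beta> - \<gamma> = (\<Sum>i = 1..l. real (c i) *\<^sub>R simple_root e l i)))"

definition affine_root :: "(nat \<Rightarrow> real ^ 'n) \<Rightarrow> nat \<Rightarrow> nat \<Rightarrow> real ^ 'n" where
  "affine_root e l i = (if i = 0 then - highest_root e l else simple_root e l i)"

definition reflection :: "real ^ 'n \<Rightarrow> real ^ 'n \<Rightarrow> real ^ 'n" where
  "reflection a x = x - (2 * (x \<bullet> a) / (a \<bullet> a)) *\<^sub>R a"

text \<open>The leftmost vector of the list gives the reflection applied last.\<close>

definition refl_word :: "(real ^ 'n) list \<Rightarrow> real ^ 'n \<Rightarrow> real ^ 'n" where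
  "refl_word as = foldr (\<lambda>a w. reflection a \<circ> w) as id"

text \<open>
  The group generated by the reflections along the vectors of \<open>A\<close>. Reflections are involutions, so the
  products of generators already form a group.
\<close>

definition refl_group :: "(real ^ 'n) set \<Rightarrow> (real ^ 'n \<Rightarrow> real ^ 'n) set" where
  "refl_group A = {refl_word as | as. set as \<subseteq> A}"

text \<open>
  Only meaningful for \<open>w\<close> in the Weyl group, where some word exists. The same length is used below for the
  standard parabolic subgroups.
\<close>

definition weyl_length ::
    "(nat \<Rightarrow> real ^ 'n) \<Rightarrow> nat \<Rightarrow> (real ^ 'n \<Rightarrow> real ^ 'n) \<Rightarrow> nat" where
  "weyl_length e l w =
     (LEAST k. \<exists>as. set as \<subseteq> simple_root e l ` {1..l} \<and> length as = k \<and> w = refl_word as)"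

definition longest_element ::
    "(nat \<Rightarrow> real ^ 'n) \<Rightarrow> nat \<Rightarrow> (real ^ 'n \<Rightarrow> real ^ 'n) set \<Rightarrow> real ^ 'n \<Rightarrow> real ^ 'n" where
  "longest_element e l G = (THE w. w \<in> G \<and> (\<forall>v \<in> G. weyl_length e l v \<le> weyl_length e l w))"

definition omega :: "(nat \<Rightarrow> real ^ 'n) \<Rightarrow> nat \<Rightarrow> nat \<Rightarrow> real ^ 'n \<Rightarrow> real ^ 'n" where
  "omega e l j =
     longest_element e l (refl_group (simple_root e l ` ({1..l} - {j}))) \<circ>
     longest_element e l (refl_group (roots e l))"

definition sigma :: "(nat \<Rightarrow> real ^ 'n) \<Rightarrow> nat \<Rightarrow> nat \<Rightarrow> nat \<Rightarrow> nat" where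
  "sigma e l j i = (THE k. k \<le> l \<and> omega e l j (affine_root e l i) = affine_root e l k)"

definition map_order :: "('a \<Rightarrow> 'a) \<Rightarrow> nat" where
  "map_order f = (LEAST k. 0 < k \<and> f ^^ k = id)"

definition orbit_mean :: "(real ^ 'n \<Rightarrow> real ^ 'n) \<Rightarrow> real ^ 'n \<Rightarrow> real ^ 'n" where
  "orbit_mean w x = (1 / real (map_order w)) *\<^sub>R (\<Sum>t = 1..map_order w. (w ^^ t) x)"

definition fund_coweight :: "(nat \<Rightarrow> real ^ 'n) \<Rightarrow> nat \<Rightarrow> nat \<Rightarrow> real ^ 'n" where
  "fund_coweight e l i =
     (if i = 0 then 0
      else (THE v. \<forall>k \<in> {1..l}. simple_root e l k \<bullet> v = (if k = i then 1 else 0)))"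

definition pi_zero :: "(nat \<Rightarrow> real ^ 'n) \<Rightarrow> nat \<Rightarrow> nat \<Rightarrow> real ^ 'n" where
  "pi_zero e l j = (\<Sum>i \<in> {(sigma e l j ^^ t) 0 | t. True}. fund_coweight e l i)"

definition pos_roots_mean_zero :: "(nat \<Rightarrow> real ^ 'n) \<Rightarrow> nat \<Rightarrow> nat \<Rightarrow> (real ^ 'n) set" where
  "pos_roots_mean_zero e l j = {\<beta> \<in> pos_roots e l. orbit_mean (omega e l j) \<beta> = 0}"

definition P_zero :: "(nat \<Rightarrow> real ^ 'n) \<Rightarrow> nat \<Rightarrow> nat \<Rightarrow> real set" where
  "P_zero e l j = {\<gamma> \<bullet> pi_zero e l j | \<gamma>. \<gamma> \<in> roots e l \<and> orbit_mean (omega e l j) \<gamma> = 0}"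

end

theory Submission
  imports Defs
begin

text \<open>
  For a node \<open>j \<in> {l - 1, l}\<close> let \<open>f\<close> be the basis \<open>e\<close>, with the sign of its last vector reversed when
  \<open>j = l - 1\<close>. The roots are still the vectors \<open>\<plusminus>f p \<plusminus> f q\<close>, the simple root \<open>\<alpha> j\<close> is \<open>f (l - 1) + f l\<close>, and
  the other simple roots are the differences of consecutive vectors of \<open>f\<close>. Both nodes are thus treated
  at once.

  The heart of the matter is to determine \<open>\<omega> = w\<^sub>j w\<^sub>0\<close>. As \<open>l\<close> is even, \<open>w\<^sub>0 = - id\<close>. The parabolic subgroup
  of \<open>w\<^sub>j\<close> is the symmetric group that permutes the vectors of \<open>f\<close>, so \<open>w\<^sub>j\<close> reverses their order, and
  \<open>\<omega> (f k) = - f (l + 1 - k)\<close>. In other words, \<open>\<omega>\<close> is the product of the reflections along the pairwise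
  orthogonal roots \<open>f i + f (l + 1 - i)\<close>, where \<open>1 \<le> i \<le> l div 2\<close>. Since \<open>\<omega>\<close> has order 2, the mean of a root
  vanishes exactly if \<open>\<omega>\<close> negates it, and because no \<open>k\<close> equals \<open>l + 1 - k\<close> the only such roots are
  \<open>\<plusminus>(f i + f (l + 1 - i))\<close>, which is \<open>mean_zero_roots\<close>. The root for \<open>i = 1\<close> is \<open>e 1 - e l\<close> or \<open>e 1 + e l\<close>,
  according to the node; the others do not involve \<open>e l\<close>. Telescoping sums give their expansions in
  simple roots.

  Longest elements are defined by word lengths, so the description of \<open>w\<^sub>0\<close> and \<open>w\<^sub>j\<close> needs the theorem that
  the length of \<open>w\<close> is the number of positive roots made negative by \<open>w\<close>. This is proved from the exchange
  property for any simply laced root system with a base (\<open>word_length_eq_inversions\<close>). It follows that an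
  element of a parabolic subgroup which makes every positive root of the corresponding subsystem negative
  is the unique longest one (\<open>longest_element_eq\<close>).

  Finally, \<open>\<omega>\<close> interchanges \<open>\<alpha>\<^sub>0 = - (e 1 + e 2)\<close> and \<open>\<alpha> j\<close>, so \<open>\<pi>\<^sub>0\<close> is the fundamental coweight of \<open>j\<close>. This is
  half the sum of the vectors of \<open>f\<close>, whose inner product with \<open>f i + f (l + 1 - i)\<close> is 1.
\<close>

section \<open>Words in reflections\<close>

lemma reflection_orthogonal: "orthogonal_transformation (reflection a)"
proof (cases "a = 0")
  case True
  then show ?thesis
    by (simp add: reflection_def orthogonal_transformation_def linear_iff)
next
  case False
  then have na: "a \<bullet> a \<noteq> 0" by simp
  have "linear (reflection a)"
    by (rule linearI)
      (auto simp: reflection_def algebra_simps inner_left_distrib add_divide_distrib)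
  moreover have "reflection a v \<bullet> reflection a w = v \<bullet> w" for v w
  proof -
    define c d where "c = 2 * (v \<bullet> a) / (a \<bullet> a)" and "d = 2 * (w \<bullet> a) / (a \<bullet> a)"
    have cd: "c * (a \<bullet> a) = 2 * (v \<bullet> a)" "d * (a \<bullet> a) = 2 * (w \<bullet> a)"
      using na by (simp_all add: c_def d_def)
    have "reflection a v \<bullet> reflection a w = (v - c *\<^sub>R a) \<bullet> (w - d *\<^sub>R a)"
      by (simp add: reflection_def c_def d_def)
    also have "\<dots> = v \<bullet> w - d * (v \<bullet> a) - c * (w \<bullet> a) + c * (d * (a \<bullet> a))"
      by (simp add: inner_diff_left inner_diff_right inner_commute[of a w] algebra_simps)
    also have "\<dots> = v \<bullet> w + (c * (w \<bullet> a) - d * (v \<bullet> a))"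
      unfolding cd by simp
    also have "c * (w \<bullet> a) = d * (v \<bullet> a)"
      by (simp add: c_def d_def)
    finally show ?thesis by simp
  qed
  ultimately show ?thesis
    by (simp add: orthogonal_transformation_def)
qed

lemma reflection_involution: "reflection a (reflection a x) = x"
proof (cases "a = 0")
  case False
  then have "reflection a x \<bullet> a = - (x \<bullet> a)"
    by (simp add: reflection_def inner_diff_left)
  then show ?thesis
    by (simp add: reflection_def)
qed (simp add: reflection_def)

lemma reflection_uminus: "reflection (- \<beta>) = reflection \<beta>"
  by (auto simp: reflection_def)

lemma refl_word_Nil [simp]: "refl_word [] = id"
  by (simp add: refl_word_def)

lemma refl_word_Cons [simp]: "refl_word (a # as) = reflection a \<circ> refl_word as"
  by (simp add: refl_word_def)

lemma refl_word_append: "refl_word (as @ bs) = refl_word as \<circ> refl_word bs"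
  by (induction as) (auto simp: comp_assoc)

lemma refl_word_orthogonal: "orthogonal_transformation (refl_word as)"
proof (induction as)
  case Nil
  show ?case by (simp add: id_def)
next
  case (Cons a as)
  show ?case
    unfolding refl_word_Cons by (rule orthogonal_transformation_compose[OF reflection_orthogonal Cons])
qed

lemma refl_word_inner: "refl_word as x \<bullet> refl_word as y = x \<bullet> y"
  using refl_word_orthogonal[of as] by (simp add: orthogonal_transformation_def)

lemma refl_word_linear: "linear (refl_word as)"
  using refl_word_orthogonal[of as] by (simp add: orthogonal_transformation_def)

lemma reflection_conjugate:
  assumes "orthogonal_transformation w"
  shows "w \<circ> reflection a = reflection (w a) \<circ> w"
proof -
  have "linear w" and "\<And>x y. w x \<bullet> w y = x \<bullet> y"
    using assms by (auto simp: orthogonal_transformation_def)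
  then show ?thesis
    by (auto simp: reflection_def fun_eq_iff linear_diff linear_scale)
qed

lemma refl_word_fixes:
  assumes "\<And>a. a \<in> set as \<Longrightarrow> a \<bullet> x = 0"
  shows "refl_word as x = x"
  using assms by (induction as) (auto simp: reflection_def inner_commute)

lemma refl_group_comp:
  assumes "v \<in> refl_group A" and "w \<in> refl_group A"
  shows "v \<circ> w \<in> refl_group A"
proof -
  obtain as bs where "v = refl_word as" "set as \<subseteq> A" "w = refl_word bs" "set bs \<subseteq> A"
    using assms by (auto simp: refl_group_def)
  then have "v \<circ> w = refl_word (as @ bs)" and "set (as @ bs) \<subseteq> A"
    by (auto simp: refl_word_append)
  then show ?thesis unfolding refl_group_def by blast
qed

lemma refl_group_mono: "A \<subseteq> B \<Longrightarrow> refl_group A \<subseteq> refl_group B"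
  by (auto simp: refl_group_def)

lemma refl_group_subset:
  assumes "\<And>a. a \<in> A \<Longrightarrow> reflection a \<in> refl_group B"
  shows "refl_group A \<subseteq> refl_group B"
proof -
  have "refl_word as \<in> refl_group B" if "set as \<subseteq> A" for as
    using that
  proof (induction as)
    case Nil
    have "id = refl_word []" and "set [] \<subseteq> B" by auto
    then show ?case unfolding refl_group_def by (metis (mono_tags, lifting) mem_Collect_eq)
  next
    case (Cons a as)
    show ?case unfolding refl_word_Cons by (rule refl_group_comp) (use Cons assms in auto)
  qed
  then show ?thesis by (auto simp: refl_group_def)
qed

text \<open>
  The word length with respect to an arbitrary set of generators; it specialises to \<open>weyl_length\<close> when the
  generators are the simple roots (\<open>weyl_length_eq\<close>).
\<close>

definition word_length :: "(real ^ 'n) set \<Rightarrow> (real ^ 'n \<Rightarrow> real ^ 'n) \<Rightarrow> nat" where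
  "word_length D w = (LEAST k. \<exists>as. set as \<subseteq> D \<and> length as = k \<and> w = refl_word as)"

section \<open>Lengths and inversions in a simply laced root system\<close>

inductive_set nat_cone :: "(real ^ 'n) set \<Rightarrow> (real ^ 'n) set" for D where
  zero: "0 \<in> nat_cone D"
| add_gen: "x \<in> nat_cone D \<Longrightarrow> a \<in> D \<Longrightarrow> x + a \<in> nat_cone D"

lemma nat_cone_gen: "a \<in> D \<Longrightarrow> a \<in> nat_cone D"
  using nat_cone.add_gen[OF nat_cone.zero] by simp

lemma nat_cone_add:
  assumes "x \<in> nat_cone D" and "y \<in> nat_cone D"
  shows "x + y \<in> nat_cone D"
  using assms(2,1)
  by induction (auto simp: add.assoc[symmetric] intro: nat_cone.add_gen)

lemma nat_cone_inner_nonneg: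
  assumes "x \<in> nat_cone D" and "\<And>a. a \<in> D \<Longrightarrow> 0 \<le> a \<bullet> v"
  shows "0 \<le> x \<bullet> v"
  using assms by induction (auto simp: inner_left_distrib)

text \<open>
  A vanishing sum of nonnegative numbers has vanishing terms: the part of the cone on a supporting
  hyperplane is generated by the generators on that hyperplane.
\<close>

lemma nat_cone_orthogonal_face:
  assumes "x \<in> nat_cone D" and "\<And>a. a \<in> D \<Longrightarrow> 0 \<le> a \<bullet> v" and "x \<bullet> v = 0"
  shows "x \<in> nat_cone {a \<in> D. a \<bullet> v = 0}"
  using assms
proof induction
  case (add_gen x a)
  have "0 \<le> x \<bullet> v" "0 \<le> a \<bullet> v"
    using add_gen nat_cone_inner_nonneg[of x D v] by auto
  with add_gen.prems have "x \<bullet> v = 0" "a \<bullet> v = 0"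
    by (auto simp: inner_left_distrib)
  with add_gen show ?case by (auto intro: nat_cone.add_gen)
qed (auto intro: nat_cone.zero)

lemma nat_cone_pos_inner_gen:
  assumes "x \<in> nat_cone D" and "0 < x \<bullet> y"
  obtains a where "a \<in> D" and "0 < a \<bullet> y"
proof -
  have "\<not> 0 < x \<bullet> y" if "\<And>a. a \<in> D \<Longrightarrow> a \<bullet> y \<le> 0"
    using assms(1)
    by induction (use that in \<open>auto simp: inner_left_distrib not_less intro!: add_nonpos_nonpos\<close>)
  with assms(2) that show thesis by force
qed

lemma nat_cone_image_iff:
  assumes "finite I"
  shows "x \<in> nat_cone (a ` I) \<longleftrightarrow> (\<exists>c :: nat \<Rightarrow> nat. x = (\<Sum>i\<in>I. real (c i) *\<^sub>R a i))"
proof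
  assume "x \<in> nat_cone (a ` I)"
  then show "\<exists>c :: nat \<Rightarrow> nat. x = (\<Sum>i\<in>I. real (c i) *\<^sub>R a i)"
  proof induction
    case zero
    show ?case by (rule exI[of _ "\<lambda>_. 0"]) simp
  next
    case (add_gen x b)
    then obtain c :: "nat \<Rightarrow> nat" and k where c: "x = (\<Sum>i\<in>I. real (c i) *\<^sub>R a i)" "b = a k" "k \<in> I"
      by auto
    have "(\<Sum>i\<in>I. real ((c(k := c k + 1)) i) *\<^sub>R a i)
        = (\<Sum>i\<in>I. real (c i) *\<^sub>R a i + (if i = k then a i else 0))"
      by (rule sum.cong) (auto simp: algebra_simps)
    also have "\<dots> = x + b"
      using c assms by (simp add: sum.distrib)
    finally show ?case by metis
  qed
next
  assume "\<exists>c :: nat \<Rightarrow> nat. x = (\<Sum>i\<in>I. real (c i) *\<^sub>R a i)"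
  then obtain c :: "nat \<Rightarrow> nat" where c: "x = (\<Sum>i\<in>I. real (c i) *\<^sub>R a i)" by blast
  have mult: "real n *\<^sub>R a i \<in> nat_cone (a ` I)" if "i \<in> I" for n i
    by (induction n)
      (use that in \<open>simp_all add: nat_cone.zero scaleR_add_left nat_cone_add nat_cone_gen\<close>)
  have "sum (\<lambda>i. real (c i) *\<^sub>R a i) F \<in> nat_cone (a ` I)" if "finite F" "F \<subseteq> I" for F
    using that by induction (auto intro!: nat_cone.zero nat_cone_add mult)
  with c assms show "x \<in> nat_cone (a ` I)" by simp
qed

text \<open>
  The functional \<open>x \<bullet> \<rho>\<close> is the height: it counts simple roots with multiplicity, and its sign tells positive
  from negative roots. All roots having squared length 2, the reflection along a root \<open>\<beta>\<close> is
  \<open>x - (x \<bullet> \<beta>) \<beta>\<close>.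
\<close>

locale simply_laced_base =
  fixes R D :: "(real ^ 'n) set" and \<rho> :: "real ^ 'n"
  assumes finite_roots: "finite R"
    and base_subset: "D \<subseteq> R"
    and root_norm: "\<beta> \<in> R \<Longrightarrow> \<beta> \<bullet> \<beta> = 2"
    and root_inner: "\<beta> \<in> R \<Longrightarrow> \<gamma> \<in> R \<Longrightarrow> \<beta> \<bullet> \<gamma> \<in> \<int>"
    and reflection_root: "\<beta> \<in> R \<Longrightarrow> \<gamma> \<in> R \<Longrightarrow> reflection \<beta> \<gamma> \<in> R"
    and base_height: "\<alpha> \<in> D \<Longrightarrow> \<alpha> \<bullet> \<rho> = 1"
    and root_cone: "\<beta> \<in> R \<Longrightarrow> \<beta> \<in> nat_cone D \<or> - \<beta> \<in> nat_cone D"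
begin

lemma reflection_root_eq: "\<beta> \<in> R \<Longrightarrow> reflection \<beta> x = x - (x \<bullet> \<beta>) *\<^sub>R \<beta>"
  by (simp add: reflection_def root_norm)

lemma uminus_root: "\<beta> \<in> R \<Longrightarrow> - \<beta> \<in> R"
  using reflection_root[of \<beta> \<beta>] by (simp add: reflection_root_eq root_norm scaleR_2)

lemma cone_height:
  assumes "x \<in> nat_cone D"
  shows "x \<bullet> \<rho> \<in> \<nat> \<and> (x \<bullet> \<rho> = 0 \<longrightarrow> x = 0)"
  using assms
proof induction
  case (add_gen x a)
  then have "0 \<le> x \<bullet> \<rho>" by (auto simp: Nats_def)
  with add_gen show ?case by (auto simp: inner_left_distrib base_height)
qed auto

lemma root_height: "\<beta> \<in> R \<Longrightarrow> \<beta> \<bullet> \<rho> \<in> \<int> \<and> \<beta> \<bullet> \<rho> \<noteq> 0"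
  using root_cone[of \<beta>] cone_height[of \<beta>] cone_height[of "- \<beta>"] root_norm[of \<beta>]
    Nats_subset_Ints minus_in_Ints_iff[of "\<beta> \<bullet> \<rho>"]
  by fastforce

lemma pos_root_iff: "\<beta> \<in> R \<Longrightarrow> \<beta> \<in> nat_cone D \<longleftrightarrow> 0 < \<beta> \<bullet> \<rho>"
  using root_cone[of \<beta>] root_height[of \<beta>] nat_cone_inner_nonneg[of "\<beta>" D \<rho>]
    nat_cone_inner_nonneg[of "- \<beta>" D \<rho>]
  by (auto simp: base_height)

lemma pos_root_height: "\<beta> \<in> R \<Longrightarrow> 0 < \<beta> \<bullet> \<rho> \<Longrightarrow> 1 \<le> \<beta> \<bullet> \<rho>"
  using root_height[of \<beta>] by (auto elim!: Ints_cases)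

lemma root_inner_le:
  assumes "\<beta> \<in> R" "\<gamma> \<in> R" "\<beta> \<noteq> \<gamma>"
  shows "\<beta> \<bullet> \<gamma> \<le> 1"
proof -
  have "0 < (\<beta> - \<gamma>) \<bullet> (\<beta> - \<gamma>)" using assms by simp
  then have "\<beta> \<bullet> \<gamma> < 2"
    using assms by (simp add: inner_diff_left inner_diff_right root_norm inner_commute)
  then show ?thesis using root_inner[OF assms(1,2)] by (auto elim!: Ints_cases)
qed

text \<open>
  A simple reflection along \<open>\<alpha>\<close> lowers the height of \<open>\<beta>\<close> by \<open>\<beta> \<bullet> \<alpha>\<close>, which is at most 1 for \<open>\<beta> \<noteq> \<alpha>\<close>. A positive
  root has height at least 1 and no root has height 0, so the reflected root stays positive.
\<close>

lemma simple_reflection_pos: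
  assumes "\<alpha> \<in> D" "\<beta> \<in> R" "0 < \<beta> \<bullet> \<rho>" "\<beta> \<noteq> \<alpha>"
  shows "0 < reflection \<alpha> \<beta> \<bullet> \<rho>"
proof -
  have "\<alpha> \<in> R" using assms base_subset by auto
  have "reflection \<alpha> \<beta> \<bullet> \<rho> = \<beta> \<bullet> \<rho> - \<beta> \<bullet> \<alpha>"
    using assms \<open>\<alpha> \<in> R\<close> by (simp add: reflection_root_eq inner_diff_left base_height)
  moreover have "\<beta> \<bullet> \<alpha> \<le> 1" "1 \<le> \<beta> \<bullet> \<rho>"
    using assms \<open>\<alpha> \<in> R\<close> root_inner_le pos_root_height by auto
  moreover have "reflection \<alpha> \<beta> \<bullet> \<rho> \<noteq> 0"
    using reflection_root root_height assms \<open>\<alpha> \<in> R\<close> by blast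
  ultimately show ?thesis by linarith
qed

lemma refl_word_root: "set as \<subseteq> R \<Longrightarrow> \<beta> \<in> R \<Longrightarrow> refl_word as \<beta> \<in> R"
  by (induction as) (auto intro: reflection_root)

text \<open>
  Follow \<open>\<alpha>\<close> through the word from right to left. The letter \<open>a\<close> at which it first becomes negative must be
  its current image, because a simple reflection makes only its own root negative. Conjugation then moves
  the reflection along \<open>\<alpha>\<close> to the place of \<open>a\<close>, and the two cancel.
\<close>

lemma exchange:
  assumes "set as \<subseteq> D" and "\<alpha> \<in> D" and "refl_word as \<alpha> \<bullet> \<rho> < 0"
  shows "\<exists>bs. set bs \<subseteq> D \<and> length bs < length as \<and> refl_word as \<circ> reflection \<alpha> = refl_word bs"
  using assms
proof (induction as)
  case Nil
  then show ?case by (simp add: base_height)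
next
  case (Cons a as)
  let ?\<beta> = "refl_word as \<alpha>"
  have as: "set as \<subseteq> D" "a \<in> D" using Cons.prems by auto
  have \<beta>: "?\<beta> \<in> R" by (rule refl_word_root) (use Cons.prems base_subset in auto)
  show ?case
  proof (cases "?\<beta> \<bullet> \<rho> < 0")
    case True
    then obtain bs where bs: "set bs \<subseteq> D" "length bs < length as"
      "refl_word as \<circ> reflection \<alpha> = refl_word bs"
      using Cons.IH[OF as(1) Cons.prems(2)] by blast
    then have "refl_word (a # as) \<circ> reflection \<alpha> = refl_word (a # bs)"
      by (simp only: refl_word_Cons comp_assoc)
    moreover have "set (a # bs) \<subseteq> D" "length (a # bs) < length (a # as)" using bs as by auto
    ultimately show ?thesis by blast
  next
    case False
    then have "0 < ?\<beta> \<bullet> \<rho>" using root_height[OF \<beta>] by simp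
    then have "?\<beta> = a"
      using simple_reflection_pos[of a ?\<beta>] Cons.prems as \<beta> by force
    then have "refl_word as \<circ> reflection \<alpha> = reflection a \<circ> refl_word as"
      using reflection_conjugate[OF refl_word_orthogonal, of as \<alpha>] by simp
    then have "refl_word (a # as) \<circ> reflection \<alpha> = refl_word as"
      by (auto simp: fun_eq_iff reflection_involution)
    moreover have "length as < length (a # as)" by simp
    ultimately show ?thesis using as by blast
  qed
qed

definition inversions :: "(real ^ 'n \<Rightarrow> real ^ 'n) \<Rightarrow> (real ^ 'n) set" where
  "inversions w = {\<beta> \<in> R. 0 < \<beta> \<bullet> \<rho> \<and> w \<beta> \<bullet> \<rho> < 0}"

lemma finite_inversions: "finite (inversions w)"
  using finite_roots by (simp add: inversions_def)

lemma card_inversions_step: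
  assumes w: "linear w" and "\<alpha> \<in> D" and pos: "0 < w \<alpha> \<bullet> \<rho>"
  shows "card (inversions (w \<circ> reflection \<alpha>)) = Suc (card (inversions w))"
proof -
  let ?s = "reflection \<alpha>"
  have \<alpha>: "\<alpha> \<in> R" "\<alpha> \<bullet> \<rho> = 1" using \<open>\<alpha> \<in> D\<close> base_subset base_height by auto
  have s\<alpha>: "?s \<alpha> = - \<alpha>" using \<alpha> by (simp add: reflection_root_eq root_norm scaleR_2)
  have "inversions (w \<circ> ?s) = insert \<alpha> (?s ` inversions w)"
  proof (intro equalityI subsetI)
    fix \<beta> assume \<beta>: "\<beta> \<in> inversions (w \<circ> ?s)"
    show "\<beta> \<in> insert \<alpha> (?s ` inversions w)"
    proof (cases "\<beta> = \<alpha>")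
      case False
      then have "?s \<beta> \<in> inversions w"
        using \<beta> \<alpha> \<open>\<alpha> \<in> D\<close> simple_reflection_pos reflection_root by (auto simp: inversions_def)
      then show ?thesis by (metis imageI insertI2 reflection_involution)
    qed simp
  next
    fix \<beta> assume "\<beta> \<in> insert \<alpha> (?s ` inversions w)"
    then consider "\<beta> = \<alpha>" | \<gamma> where "\<gamma> \<in> inversions w" "\<beta> = ?s \<gamma>" by auto
    then show "\<beta> \<in> inversions (w \<circ> ?s)"
    proof cases
      case 1
      then show ?thesis using \<alpha> s\<alpha> pos by (simp add: inversions_def linear_neg[OF w])
    next
      case 2
      then have "\<gamma> \<noteq> \<alpha>" using pos by (auto simp: inversions_def)
      with 2 show ?thesis
        using \<alpha> \<open>\<alpha> \<in> D\<close> simple_reflection_pos reflection_root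
        by (auto simp: inversions_def reflection_involution)
    qed
  qed
  moreover have "\<alpha> \<notin> ?s ` inversions w"
  proof
    assume "\<alpha> \<in> ?s ` inversions w"
    then have "?s \<alpha> \<in> inversions w" by (metis imageE reflection_involution)
    then show False using s\<alpha> \<alpha> by (simp add: inversions_def)
  qed
  moreover have "inj_on ?s (inversions w)"
    by (metis inj_onI reflection_involution)
  ultimately show ?thesis
    by (simp add: finite_inversions card_image)
qed

text \<open>
  Deleting the last letter \<open>\<alpha>\<close> of a reduced word leaves a reduced word, which sends \<open>\<alpha>\<close> to a positive root,
  for otherwise the exchange property would shorten the given word. So each letter adds one inversion.
\<close>

lemma card_inversions_reduced:
  assumes "set as \<subseteq> D"
    and "\<And>bs. set bs \<subseteq> D \<Longrightarrow> refl_word bs = refl_word as \<Longrightarrow> length as \<le> length bs"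
  shows "card (inversions (refl_word as)) = length as"
  using assms
proof (induction as rule: rev_induct)
  case Nil
  have "inversions (refl_word []) = {}" by (auto simp: inversions_def)
  then show ?case by (simp only: card.empty list.size)
next
  case (snoc \<alpha> as)
  have \<alpha>: "\<alpha> \<in> D" and as: "set as \<subseteq> D" using snoc.prems by auto
  have word: "refl_word (as @ [\<alpha>]) = refl_word as \<circ> reflection \<alpha>"
    by (simp add: refl_word_append)
  have "length as \<le> length bs" if bs: "set bs \<subseteq> D" "refl_word bs = refl_word as" for bs
  proof -
    have "refl_word (bs @ [\<alpha>]) = refl_word (as @ [\<alpha>])" using bs by (simp add: refl_word_append)
    then show ?thesis using snoc.prems(2)[of "bs @ [\<alpha>]"] bs \<alpha> by simp
  qed
  then have IH: "card (inversions (refl_word as)) = length as" using snoc.IH as by blast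
  have "\<not> refl_word as \<alpha> \<bullet> \<rho> < 0"
  proof
    assume "refl_word as \<alpha> \<bullet> \<rho> < 0"
    then obtain bs where "set bs \<subseteq> D" "length bs < length as" "refl_word (as @ [\<alpha>]) = refl_word bs"
      using exchange[OF as \<alpha>] word by metis
    then show False using snoc.prems(2)[of bs] by simp
  qed
  moreover have "refl_word as \<alpha> \<in> R" by (rule refl_word_root) (use as \<alpha> base_subset in auto)
  ultimately have "0 < refl_word as \<alpha> \<bullet> \<rho>" using root_height by force
  then show ?case
    using card_inversions_step[OF refl_word_linear \<alpha>, of as] IH by (simp only: word length_append list.size)
qed

lemma reduced_word:
  assumes "w \<in> refl_group D"
  obtains as where "set as \<subseteq> D" and "w = refl_word as" and "length as = word_length D w"
    and "card (inversions w) = length as"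
proof -
  let ?P = "\<lambda>k. \<exists>as. set as \<subseteq> D \<and> length as = k \<and> w = refl_word as"
  have "\<exists>k. ?P k" using assms by (auto simp: refl_group_def)
  then have "?P (word_length D w)" unfolding word_length_def by (rule LeastI_ex)
  then obtain as where as: "set as \<subseteq> D" "length as = word_length D w" "w = refl_word as" by blast
  have "length as \<le> length bs" if "set bs \<subseteq> D" "refl_word bs = refl_word as" for bs
    unfolding as(2) word_length_def by (rule Least_le) (use that as in auto)
  then show thesis
    using card_inversions_reduced[of as] that as by blast
qed

lemma word_length_eq_inversions:
  "w \<in> refl_group D \<Longrightarrow> word_length D w = card (inversions w)"
  by (metis reduced_word)

lemma no_inversions_id:
  assumes "w \<in> refl_group D" and "inversions w = {}"
  shows "w = id"
  using reduced_word[OF assms(1)] assms(2) by (metis card.empty length_0_conv refl_word_Nil)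

text \<open>
  An element \<open>u\<close> of \<open>G\<close> fixes \<open>v\<close>, on which positive roots are nonnegative. Hence \<open>u\<close> can invert only positive
  roots orthogonal to \<open>v\<close>, and \<open>w\<close> inverts all of these, so \<open>w\<close> has maximal length. If \<open>u\<close> inverts them all as
  well, then \<open>u \<circ> w\<close> has no inversion, and so is the identity; applied to \<open>u = w\<close> this shows that \<open>w\<close> is its
  own inverse, whence \<open>u = w\<close>. The choice \<open>v = 0\<close> gives the longest element of the whole group.
\<close>

lemma longest_element_eq:
  fixes v :: "real ^ 'n"
  defines "G \<equiv> refl_group {\<alpha> \<in> D. \<alpha> \<bullet> v = 0}"
  assumes dominant: "\<And>\<alpha>. \<alpha> \<in> D \<Longrightarrow> 0 \<le> \<alpha> \<bullet> v"
    and w: "w \<in> G"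
    and neg: "\<And>\<beta>. \<beta> \<in> R \<Longrightarrow> 0 < \<beta> \<bullet> \<rho> \<Longrightarrow> \<beta> \<bullet> v = 0 \<Longrightarrow> w \<beta> \<bullet> \<rho> < 0"
  shows "(THE x. x \<in> G \<and> (\<forall>y \<in> G. word_length D y \<le> word_length D x)) = w"
proof -
  let ?P = "{\<beta> \<in> R. 0 < \<beta> \<bullet> \<rho> \<and> \<beta> \<bullet> v = 0}"
  have GD: "G \<subseteq> refl_group D" unfolding G_def by (rule refl_group_mono) auto
  have fix_v: "u x \<bullet> v = x \<bullet> v" if u: "u \<in> G" for u x
  proof -
    obtain as where as: "u = refl_word as" "set as \<subseteq> {\<alpha> \<in> D. \<alpha> \<bullet> v = 0}"
      using u unfolding G_def refl_group_def by blast
    then have "u v = v" using refl_word_fixes[of as v] by auto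
    then show ?thesis using refl_word_inner[of as x v] as by simp
  qed
  have root: "u \<beta> \<in> R" if "u \<in> G" "\<beta> \<in> R" for u \<beta>
    using that base_subset refl_word_root by (fastforce simp: G_def refl_group_def)
  have lin: "linear u" if "u \<in> G" for u
    using that refl_word_linear by (auto simp: G_def refl_group_def)
  have inv_sub: "inversions u \<subseteq> ?P" if u: "u \<in> G" for u
  proof
    fix \<beta> assume \<beta>: "\<beta> \<in> inversions u"
    then have \<beta>R: "\<beta> \<in> R" "0 < \<beta> \<bullet> \<rho>" "u \<beta> \<bullet> \<rho> < 0" by (auto simp: inversions_def)
    have "- u \<beta> \<in> R" using \<beta>R root u uminus_root by blast
    then have "0 \<le> - u \<beta> \<bullet> v"
      using \<beta>R pos_root_iff nat_cone_inner_nonneg[of "- u \<beta>" D v] dominant by simp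
    moreover have "0 \<le> \<beta> \<bullet> v"
      using \<beta>R pos_root_iff nat_cone_inner_nonneg[of \<beta> D v] dominant by simp
    ultimately show "\<beta> \<in> ?P" using fix_v[OF u, of \<beta>] \<beta>R by simp
  qed
  have inv_w: "inversions w = ?P"
    using inv_sub[OF w] neg by (auto simp: inversions_def)
  have fin: "finite ?P" using finite_roots by simp
  have cancel: "u \<circ> w = id" if u: "u \<in> G" "inversions u = ?P" for u
  proof -
    have uw: "u \<circ> w \<in> G" using u w refl_group_comp unfolding G_def by blast
    have "\<beta> \<notin> inversions (u \<circ> w)" if "\<beta> \<in> ?P" for \<beta>
    proof -
      have "- w \<beta> \<in> ?P"
        using that neg[of \<beta>] fix_v[OF w, of \<beta>] uminus_root[OF root[OF w, of \<beta>]] by simp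
      then have "- w \<beta> \<in> inversions u" using u by blast
      then have "u (- w \<beta>) \<bullet> \<rho> < 0" by (simp add: inversions_def)
      then show ?thesis using lin[OF u(1)] by (simp add: linear_neg inversions_def)
    qed
    then have "inversions (u \<circ> w) = {}" using inv_sub[OF uw] by blast
    then show ?thesis using no_inversions_id uw GD by blast
  qed
  have len: "word_length D u = card (inversions u)" if "u \<in> G" for u
    using that GD word_length_eq_inversions by blast
  have le: "word_length D u \<le> word_length D w" if "u \<in> G" for u
    unfolding len[OF that] len[OF w] inv_w using inv_sub[OF that] by (rule card_mono[OF fin])
  show ?thesis
  proof (rule the_equality)
    show "w \<in> G \<and> (\<forall>y\<in>G. word_length D y \<le> word_length D w)" using w le by blast
  next
    fix u assume u: "u \<in> G \<and> (\<forall>y\<in>G. word_length D y \<le> word_length D u)"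
    then have "card (inversions u) = card ?P"
      using le[of u] w len[of u] len[OF w] inv_w by (metis le_antisym)
    then have "inversions u = ?P"
      using inv_sub[of u] u by (intro card_subset_eq[OF fin]) auto
    then have "u \<circ> w = id" using cancel u by blast
    moreover have "w \<circ> w = id" using cancel w inv_w by blast
    ultimately show "u = w" by (metis comp_assoc comp_id id_comp)
  qed
qed

text \<open>
  Induction on the height. The simple roots in the expansion of \<open>\<beta>\<close> are all orthogonal to \<open>v\<close>, and \<open>\<beta>\<close> has a
  positive inner product with one of them, say \<open>\<alpha>\<close>. Unless \<open>\<beta> = \<alpha>\<close>, reflecting \<open>\<beta>\<close> along \<open>\<alpha>\<close> lowers its
  height, and the reflection along the new root is conjugate to the old one.
\<close>

lemma reflection_in_parabolic:
  assumes dominant: "\<And>\<alpha>. \<alpha> \<in> D \<Longrightarrow> 0 \<le> \<alpha> \<bullet> v"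
    and "\<beta> \<in> R" "0 < \<beta> \<bullet> \<rho>" "\<beta> \<bullet> v = 0"
  shows "reflection \<beta> \<in> refl_group {\<alpha> \<in> D. \<alpha> \<bullet> v = 0}"
  using assms(2-)
proof (induction "nat \<lfloor>\<beta> \<bullet> \<rho>\<rfloor>" arbitrary: \<beta> rule: less_induct)
  case less
  let ?J = "{\<alpha> \<in> D. \<alpha> \<bullet> v = 0}"
  have gen: "reflection \<alpha> \<in> refl_group ?J" if "\<alpha> \<in> ?J" for \<alpha>
  proof -
    have "reflection \<alpha> = refl_word [\<alpha>]" "set [\<alpha>] \<subseteq> ?J" using that by auto
    then show ?thesis unfolding refl_group_def by blast
  qed
  have "\<beta> \<in> nat_cone ?J"
    using less.prems pos_root_iff by (intro nat_cone_orthogonal_face dominant) auto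
  moreover have "0 < \<beta> \<bullet> \<beta>" using less.prems root_norm by simp
  ultimately obtain \<alpha> where \<alpha>: "\<alpha> \<in> ?J" "0 < \<alpha> \<bullet> \<beta>" by (rule nat_cone_pos_inner_gen)
  show ?case
  proof (cases "\<beta> = \<alpha>")
    case True
    then show ?thesis using gen \<alpha> by blast
  next
    case False
    let ?\<gamma> = "reflection \<alpha> \<beta>"
    have \<alpha>R: "\<alpha> \<in> R" "\<alpha> \<in> D" "\<alpha> \<bullet> v = 0" using \<alpha> base_subset by auto
    have \<gamma>: "?\<gamma> \<in> R" "0 < ?\<gamma> \<bullet> \<rho>"
      using simple_reflection_pos reflection_root less.prems False \<alpha>R by auto
    have "?\<gamma> \<bullet> v = 0"
      using \<alpha>R less.prems by (simp add: reflection_root_eq inner_diff_left)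
    have "?\<gamma> \<bullet> \<rho> = \<beta> \<bullet> \<rho> - \<alpha> \<bullet> \<beta>"
      using \<alpha>R by (simp add: reflection_root_eq inner_diff_left base_height inner_commute[of \<beta> \<alpha>])
    moreover have "1 \<le> \<alpha> \<bullet> \<beta>" using \<alpha>(2) root_inner[OF \<alpha>R(1) less.prems(1)] by (auto elim!: Ints_cases)
    ultimately have "nat \<lfloor>?\<gamma> \<bullet> \<rho>\<rfloor> < nat \<lfloor>\<beta> \<bullet> \<rho>\<rfloor>" using \<gamma>(2) less.prems(2) by linarith
    then have "reflection ?\<gamma> \<in> refl_group ?J"
      using less.hyps \<gamma> \<open>?\<gamma> \<bullet> v = 0\<close> by blast
    then have "reflection \<alpha> \<circ> (reflection ?\<gamma> \<circ> reflection \<alpha>) \<in> refl_group ?J"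
      using gen \<alpha> refl_group_comp by blast
    moreover have "reflection \<alpha> \<circ> (reflection ?\<gamma> \<circ> reflection \<alpha>) = reflection \<beta>"
    proof
      fix x
      have "reflection ?\<gamma> (reflection \<alpha> x) = reflection \<alpha> (reflection \<beta> x)"
        using fun_cong[OF reflection_conjugate[OF reflection_orthogonal, of \<alpha> \<beta>], of x] by simp
      then show "(reflection \<alpha> \<circ> (reflection ?\<gamma> \<circ> reflection \<alpha>)) x = reflection \<beta> x"
        by (simp add: reflection_involution)
    qed
    ultimately show ?thesis by simp
  qed
qed

text \<open>
  This makes it possible to exhibit elements of a parabolic subgroup as products of reflections along
  arbitrary roots of its subsystem, without writing these as words in simple reflections.
\<close>

lemma refl_group_orthogonal_roots:
  assumes dominant: "\<And>\<alpha>. \<alpha> \<in> D \<Longrightarrow> 0 \<le> \<alpha> \<bullet> v"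
  shows "refl_group {\<beta> \<in> R. \<beta> \<bullet> v = 0} = refl_group {\<alpha> \<in> D. \<alpha> \<bullet> v = 0}"
proof
  show "refl_group {\<beta> \<in> R. \<beta> \<bullet> v = 0} \<subseteq> refl_group {\<alpha> \<in> D. \<alpha> \<bullet> v = 0}"
  proof (rule refl_group_subset)
    fix \<beta> assume \<beta>: "\<beta> \<in> {\<beta> \<in> R. \<beta> \<bullet> v = 0}"
    show "reflection \<beta> \<in> refl_group {\<alpha> \<in> D. \<alpha> \<bullet> v = 0}"
    proof (cases "0 < \<beta> \<bullet> \<rho>")
      case False
      then have "0 < - \<beta> \<bullet> \<rho>" using root_height[of \<beta>] \<beta> by auto
      then have "reflection (- \<beta>) \<in> refl_group {\<alpha> \<in> D. \<alpha> \<bullet> v = 0}"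
        using \<beta> uminus_root by (intro reflection_in_parabolic[OF dominant]) auto
      then show ?thesis by (simp add: reflection_uminus)
    qed (use \<beta> in \<open>auto intro: reflection_in_parabolic[OF dominant]\<close>)
  qed
qed (use base_subset in \<open>auto intro!: refl_group_mono\<close>)

end

section \<open>The root system of type D\<close>

text \<open>
  Every root is the sum of two orthogonal elements of this set, and reflections along roots permute it.
  It does not change when vectors of the frame are replaced by their negatives.
\<close>

definition signed_axes :: "(nat \<Rightarrow> real ^ 'n) \<Rightarrow> nat \<Rightarrow> (real ^ 'n) set" where
  "signed_axes e l = {s *\<^sub>R e k | s k. s \<in> {1, - 1} \<and> k \<in> {1..l}}"

text \<open>
  The coefficient of \<open>e l\<close> is 0, so this vector too is unaffected by a change of sign of \<open>e l\<close>.
\<close>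

definition height_vector :: "(nat \<Rightarrow> real ^ 'n) \<Rightarrow> nat \<Rightarrow> real ^ 'n" where
  "height_vector e l = (\<Sum>k = 1..l. real (l - k) *\<^sub>R e k)"

text \<open>
  An orthonormal basis that need not consist of standard basis vectors, so that signs can be changed.
  Completeness is stated in the form in which it is applied, as a uniqueness principle for linear maps.
\<close>

locale orthonormal_frame =
  fixes e :: "nat \<Rightarrow> real ^ 'n" and l :: nat
  assumes rank: "4 \<le> l"
    and orthonormal: "p \<in> {1..l} \<Longrightarrow> q \<in> {1..l} \<Longrightarrow> e p \<bullet> e q = (if p = q then 1 else 0)"
    and spanning: "linear (g :: real ^ 'n \<Rightarrow> real ^ 'n) \<Longrightarrow> linear h \<Longrightarrow> (\<And>k. k \<in> {1..l} \<Longrightarrow> g (e k) = h (e k)) \<Longrightarrow> g = h"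
begin

lemma inner_frame_sum:
  assumes "k \<in> {1..l}"
  shows "e k \<bullet> (\<Sum>i = 1..l. c i *\<^sub>R e i) = c k"
proof -
  have "e k \<bullet> (\<Sum>i = 1..l. c i *\<^sub>R e i) = (\<Sum>i = 1..l. if i = k then c k else 0)"
    unfolding inner_sum_right by (rule sum.cong) (use assms in \<open>auto simp: orthonormal\<close>)
  then show ?thesis using assms by simp
qed

lemma frame_height: "k \<in> {1..l} \<Longrightarrow> e k \<bullet> height_vector e l = real (l - k)"
  unfolding height_vector_def by (rule inner_frame_sum)

lemma simple_root_less: "k < l \<Longrightarrow> simple_root e l k = e k - e (k + 1)"
  and simple_root_last: "simple_root e l l = e (l - 1) + e l"
  by (auto simp: simple_root_def)

lemma rootE:
  assumes "\<beta> \<in> roots e l"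
  obtains s t p q where "\<beta> = s *\<^sub>R e p + t *\<^sub>R e q" "s \<in> {1, - 1}" "t \<in> {1, - 1}"
    "1 \<le> p" "p < q" "q \<le> l"
  using assms by (auto simp only: roots_def mem_Collect_eq)

lemma axisI: "s \<in> {1, - 1} \<Longrightarrow> k \<in> {1..l} \<Longrightarrow> s *\<^sub>R e k \<in> signed_axes e l"
  unfolding signed_axes_def by blast

lemma roots_eq: "roots e l = {x + y | x y. x \<in> signed_axes e l \<and> y \<in> signed_axes e l \<and> x \<bullet> y = 0}"
proof (intro equalityI subsetI)
  fix \<beta> assume "\<beta> \<in> roots e l"
  then obtain s t p q where \<beta>: "\<beta> = s *\<^sub>R e p + t *\<^sub>R e q" "s \<in> {1, - 1}" "t \<in> {1, - 1}"
    "1 \<le> p" "p < q" "q \<le> l"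
    by (rule rootE)
  then have "s *\<^sub>R e p \<in> signed_axes e l" "t *\<^sub>R e q \<in> signed_axes e l" "(s *\<^sub>R e p) \<bullet> (t *\<^sub>R e q) = 0"
    using axisI[of s p] axisI[of t q] by (simp_all add: orthonormal)
  with \<beta>(1) show "\<beta> \<in> {x + y | x y. x \<in> signed_axes e l \<and> y \<in> signed_axes e l \<and> x \<bullet> y = 0}" by blast
next
  fix \<beta> assume "\<beta> \<in> {x + y | x y. x \<in> signed_axes e l \<and> y \<in> signed_axes e l \<and> x \<bullet> y = 0}"
  then obtain s t p q where \<beta>: "\<beta> = s *\<^sub>R e p + t *\<^sub>R e q" "s \<in> {1, - 1}" "t \<in> {1, - 1}"
    "p \<in> {1..l}" "q \<in> {1..l}" "(s *\<^sub>R e p) \<bullet> (t *\<^sub>R e q) = 0"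
    unfolding signed_axes_def by blast
  then have "p \<noteq> q" by (auto simp: orthonormal)
  then consider "p < q" | "q < p" by linarith
  then show "\<beta> \<in> roots e l"
  proof cases
    case 1
    with \<beta> show ?thesis unfolding roots_def by auto
  next
    case 2
    have "\<beta> = t *\<^sub>R e q + s *\<^sub>R e p" using \<beta> by simp
    with 2 \<beta> show ?thesis unfolding roots_def mem_Collect_eq by (metis atLeastAtMost_iff)
  qed
qed

lemma axis_inner:
  assumes "x \<in> signed_axes e l" "y \<in> signed_axes e l"
  shows "x \<bullet> y = (if x = y then 1 else if x = - y then - 1 else 0)"
proof -
  obtain s p t q where *: "x = s *\<^sub>R e p" "y = t *\<^sub>R e q" "s \<in> {1, - 1}" "t \<in> {1, - 1}"
    "p \<in> {1..l}" "q \<in> {1..l}"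
    using assms unfolding signed_axes_def by blast
  have ne: "x \<noteq> y \<and> x \<noteq> - y" if "x \<bullet> y = 0"
  proof -
    have "y \<bullet> y = 1" using * by (auto simp: orthonormal)
    then show ?thesis using that by auto
  qed
  show ?thesis
  proof (cases "p = q")
    case False
    then have "x \<bullet> y = 0" using * by (simp add: orthonormal)
    then show ?thesis using ne by simp
  next
    case True
    have "e q \<bullet> e q = 1" using * by (simp add: orthonormal)
    then have "e q \<bullet> e q \<noteq> (- e q) \<bullet> e q" by simp
    then have "e q \<noteq> - e q" by metis
    moreover from this have "- e q \<noteq> e q" by metis
    ultimately show ?thesis using *(1-4) True \<open>e q \<bullet> e q = 1\<close> by auto
  qed
qed

lemma axis_uminus: "x \<in> signed_axes e l \<Longrightarrow> - x \<in> signed_axes e l"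
proof -
  assume "x \<in> signed_axes e l"
  then obtain s k where "x = s *\<^sub>R e k" "s \<in> {1, - 1}" "k \<in> {1..l}" unfolding signed_axes_def by blast
  then have "- x = (- s) *\<^sub>R e k" "- s \<in> {1, - 1}" "k \<in> {1..l}" by auto
  then show ?thesis unfolding signed_axes_def by blast
qed

text \<open>
  The reflection along \<open>x + y\<close> interchanges \<open>x\<close> and \<open>- y\<close>, and also \<open>y\<close> and \<open>- x\<close>, and fixes the axes orthogonal to
  both.
\<close>

lemma reflection_axis:
  assumes "x \<in> signed_axes e l" "y \<in> signed_axes e l" "x \<bullet> y = 0" "z \<in> signed_axes e l"
  shows "reflection (x + y) z \<in> signed_axes e l"
proof -
  have xy: "x \<bullet> x = 1" "y \<bullet> y = 1" "y \<bullet> x = 0" "x \<noteq> y" "x \<noteq> - y"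
    using assms axis_inner[of x y] axis_inner[of x x] axis_inner[of y y]
    by (auto simp: inner_commute split: if_splits)
  then have "(x + y) \<bullet> (x + y) = 2"
    using assms by (simp add: inner_left_distrib inner_right_distrib)
  then have refl: "reflection (x + y) z = z - (z \<bullet> x + z \<bullet> y) *\<^sub>R (x + y)" for z
    by (simp add: reflection_def inner_right_distrib)
  consider "z = x" | "z = - x" | "z = y" | "z = - y" | "z \<bullet> x = 0" "z \<bullet> y = 0"
    using axis_inner[of z x] axis_inner[of z y] assms by metis
  then have "reflection (x + y) z \<in> {- y, y, - x, x, z}"
    by cases (use assms xy in \<open>simp_all add: refl\<close>)
  then show ?thesis using assms axis_uminus[of x] axis_uminus[of y] by fastforce
qed

lemma finite_roots: "finite (roots e l)"
proof -
  have "finite (signed_axes e l)"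
    unfolding signed_axes_def by (rule finite_image_set2) auto
  then have "finite {x + y | x y. x \<in> signed_axes e l \<and> y \<in> signed_axes e l}"
    by (intro finite_image_set2) auto
  then show ?thesis by (rule finite_subset[rotated]) (auto simp: roots_eq)
qed

lemma rootsI:
  assumes "p \<in> {1..l}" "q \<in> {1..l}" "p \<noteq> q" "s \<in> {1, - 1}" "t \<in> {1, - 1}"
  shows "s *\<^sub>R e p + t *\<^sub>R e q \<in> roots e l"
proof -
  have "(s *\<^sub>R e p) \<bullet> (t *\<^sub>R e q) = 0" "s *\<^sub>R e p \<in> signed_axes e l" "t *\<^sub>R e q \<in> signed_axes e l"
    using assms axisI[of s p] axisI[of t q] by (simp_all add: orthonormal)
  then show ?thesis unfolding roots_eq by blast
qed

lemma diff_cone: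
  assumes "1 \<le> p" "p \<le> q" "q \<le> l"
  shows "e p - e q \<in> nat_cone (simple_root e l ` {1..l})"
  using assms(2,1,3)
proof (induction q rule: dec_induct)
  case base
  show ?case by (simp add: nat_cone.zero)
next
  case (step q)
  have "e p - e (Suc q) = (e p - e q) + simple_root e l q"
    using step.prems by (simp add: simple_root_less)
  moreover have "(e p - e q) + simple_root e l q \<in> nat_cone (simple_root e l ` {1..l})"
    using step by (intro nat_cone.add_gen) auto
  ultimately show ?case by (simp only:)
qed

text \<open>
  The case \<open>p = q\<close> is included for the highest root: \<open>e 1 + e 2 - (e 1 - e 2)\<close> is \<open>e 2 + e 2\<close>.
\<close>

lemma sum_cone:
  assumes "1 \<le> p" "p < l" "1 \<le> q" "q \<le> l"
  shows "e p + e q \<in> nat_cone (simple_root e l ` {1..l})"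
proof -
  let ?C = "nat_cone (simple_root e l ` {1..l})"
  have last: "e (l - 1) + e l \<in> ?C"
    using rank by (intro nat_cone_gen image_eqI[of _ _ l]) (auto simp: simple_root_last)
  have "(e p - e (l - 1)) + (e q - e l) + (e (l - 1) + e l) \<in> ?C"
    using assms by (intro nat_cone_add diff_cone last) auto
  then show ?thesis by (simp add: algebra_simps)
qed

lemma simple_root_in_roots:
  assumes "k \<in> {1..l}"
  shows "simple_root e l k \<in> roots e l"
proof (cases "k = l")
  case True
  then show ?thesis using rootsI[of "l - 1" l 1 1] rank by (simp add: simple_root_last)
next
  case False
  then show ?thesis using rootsI[of k "k + 1" 1 "- 1"] assms by (simp add: simple_root_less)
qed

lemma simple_root_height: "k \<in> {1..l} \<Longrightarrow> simple_root e l k \<bullet> height_vector e l = 1"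
  using rank by (auto simp: simple_root_def inner_left_distrib inner_diff_left frame_height of_nat_diff)

lemma root_cone:
  assumes "\<beta> \<in> roots e l"
  shows "\<beta> \<in> nat_cone (simple_root e l ` {1..l}) \<or> - \<beta> \<in> nat_cone (simple_root e l ` {1..l})"
proof -
  obtain s t p q where \<beta>: "\<beta> = s *\<^sub>R e p + t *\<^sub>R e q" "s \<in> {1, - 1}" "t \<in> {1, - 1}"
    "1 \<le> p" "p < q" "q \<le> l"
    using assms by (rule rootE)
  then show ?thesis using sum_cone[of p q] diff_cone[of p q] by (auto simp: algebra_simps)
qed

lemma base: "simply_laced_base (roots e l) (simple_root e l ` {1..l}) (height_vector e l)"
proof
  show "finite (roots e l)" by (rule finite_roots)
  show "simple_root e l ` {1..l} \<subseteq> roots e l" using simple_root_in_roots by blast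
  show "\<beta> \<bullet> \<beta> = 2" if \<beta>: "\<beta> \<in> roots e l" for \<beta>
  proof -
    obtain x y where "\<beta> = x + y" "x \<in> signed_axes e l" "y \<in> signed_axes e l" "x \<bullet> y = 0"
      using \<beta> unfolding roots_eq by blast
    then show ?thesis
      using axis_inner[of x x] axis_inner[of y y]
      by (simp add: inner_left_distrib inner_right_distrib inner_commute)
  qed
  show "\<beta> \<bullet> \<gamma> \<in> \<int>" if "\<beta> \<in> roots e l" "\<gamma> \<in> roots e l" for \<beta> \<gamma>
  proof -
    have "x \<bullet> y \<in> \<int>" if "x \<in> signed_axes e l" "y \<in> signed_axes e l" for x y
      using axis_inner[OF that] by simp
    with that show ?thesis by (auto simp: roots_eq inner_left_distrib inner_right_distrib)
  qed
  show "reflection \<beta> \<gamma> \<in> roots e l" if \<beta>\<gamma>: "\<beta> \<in> roots e l" "\<gamma> \<in> roots e l" for \<beta> \<gamma>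
  proof -
    obtain x y where \<gamma>: "\<gamma> = x + y" "x \<in> signed_axes e l" "y \<in> signed_axes e l" "x \<bullet> y = 0"
      using \<beta>\<gamma>(2) unfolding roots_eq by blast
    have "orthogonal_transformation (reflection \<beta>)" by (rule reflection_orthogonal)
    then have "reflection \<beta> \<gamma> = reflection \<beta> x + reflection \<beta> y"
      "reflection \<beta> x \<bullet> reflection \<beta> y = 0"
      using \<gamma> by (auto simp: orthogonal_transformation_def linear_add)
    moreover have "reflection \<beta> x \<in> signed_axes e l" "reflection \<beta> y \<in> signed_axes e l"
      using \<beta>\<gamma>(1) \<gamma> reflection_axis by (auto simp: roots_eq)
    ultimately show ?thesis unfolding roots_eq by blast
  qed
  show "\<alpha> \<bullet> height_vector e l = 1" if "\<alpha> \<in> simple_root e l ` {1..l}" for \<alpha>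
    using that simple_root_height by auto
qed (rule root_cone)

sublocale simply_laced_base "roots e l" "simple_root e l ` {1..l}" "height_vector e l"
  by (rule base)

lemma simple_root_cone_iff:
  "x \<in> nat_cone (simple_root e l ` {1..l}) \<longleftrightarrow>
    (\<exists>c :: nat \<Rightarrow> nat. x = (\<Sum>i = 1..l. real (c i) *\<^sub>R simple_root e l i))"
  by (rule nat_cone_image_iff) simp

lemma pos_roots_eq: "pos_roots e l = {\<beta> \<in> roots e l. 0 < \<beta> \<bullet> height_vector e l}"
  unfolding pos_roots_def simple_root_cone_iff[symmetric] by (intro Collect_cong conj_cong refl pos_root_iff)

lemma highest_root_eq: "highest_root e l = e 1 + e 2"
proof -
  let ?C = "nat_cone (simple_root e l ` {1..l})"
  have 1: "e 1 + e 2 - \<gamma> \<in> ?C" if \<gamma>R: "\<gamma> \<in> roots e l" for \<gamma>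
  proof -
    obtain s t p q where \<gamma>: "\<gamma> = s *\<^sub>R e p + t *\<^sub>R e q" "s \<in> {1, - 1}" "t \<in> {1, - 1}"
      "1 \<le> p" "p < q" "q \<le> l"
      using \<gamma>R by (rule rootE)
    have "e 1 - s *\<^sub>R e p \<in> ?C"
      using \<gamma> diff_cone[of 1 p] sum_cone[of 1 p] by auto
    moreover have "e 2 - t *\<^sub>R e q \<in> ?C"
      using \<gamma> diff_cone[of 2 q] sum_cone[of 2 q] rank by auto
    ultimately have "(e 1 - s *\<^sub>R e p) + (e 2 - t *\<^sub>R e q) \<in> ?C" by (rule nat_cone_add)
    then show ?thesis using \<gamma> by (simp add: algebra_simps)
  qed
  have 2: "e 1 + e 2 \<in> roots e l" using rootsI[of 1 2 1 1] rank by simp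
  have "(THE \<beta>. \<beta> \<in> roots e l \<and> (\<forall>\<gamma>\<in>roots e l. \<beta> - \<gamma> \<in> ?C)) = e 1 + e 2"
  proof (rule the_equality)
    fix \<beta> assume \<beta>: "\<beta> \<in> roots e l \<and> (\<forall>\<gamma>\<in>roots e l. \<beta> - \<gamma> \<in> ?C)"
    have nonneg: "0 \<le> x \<bullet> height_vector e l" if "x \<in> ?C" for x
      using that by (rule nat_cone_inner_nonneg) (simp add: base_height)
    have "0 \<le> (\<beta> - (e 1 + e 2)) \<bullet> height_vector e l" "0 \<le> (e 1 + e 2 - \<beta>) \<bullet> height_vector e l"
      using 1 2 \<beta> by (blast intro: nonneg)+
    then have "(e 1 + e 2 - \<beta>) \<bullet> height_vector e l = 0"
      by (simp add: inner_diff_left)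
    then show "\<beta> = e 1 + e 2"
      using cone_height[OF 1, of \<beta>] \<beta> by simp
  qed (use 1 2 in blast)
  then show ?thesis
    unfolding highest_root_def simple_root_cone_iff[symmetric] .
qed

lemma simple_root_inj:
  assumes "k \<in> {1..l}" "m \<in> {1..l}" "simple_root e l k = simple_root e l m"
  shows "k = m"
proof -
  have "simple_root e l k \<noteq> simple_root e l m" if "1 \<le> k" "k < m" "m \<le> l" for k m
  proof (cases "m = l")
    case True
    have "simple_root e l k \<bullet> e l \<le> 0" "simple_root e l m \<bullet> e l = 1"
      using that True by (auto simp: simple_root_def inner_left_distrib inner_diff_left orthonormal)
    then show ?thesis by auto
  next
    case False
    have "simple_root e l k \<bullet> e k = 1" "simple_root e l m \<bullet> e k = 0"
      using that False by (auto simp: simple_root_def inner_left_distrib inner_diff_left orthonormal)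
    then show ?thesis by auto
  qed
  then show ?thesis using assms by (metis atLeastAtMost_iff linorder_neqE_nat)
qed

lemma affine_root_inj:
  assumes "k \<le> l" "m \<le> l" "affine_root e l k = affine_root e l m"
  shows "k = m"
proof -
  have "(e 1 + e 2) \<bullet> height_vector e l > 0"
    using rank frame_height[of 1] frame_height[of 2] by (simp add: inner_left_distrib)
  then have "affine_root e l i \<bullet> height_vector e l > 0 \<longleftrightarrow> i \<noteq> 0" if "i \<le> l" for i
    using that simple_root_height[of i]
    by (cases "i = 0") (simp_all add: affine_root_def highest_root_eq inner_diff_left inner_left_distrib)
  then have "k = 0 \<longleftrightarrow> m = 0" using assms by metis
  then show ?thesis using assms simple_root_inj[of k m] by (cases "k = 0") (auto simp: affine_root_def)
qed

lemma orthogonal_simple_roots_zero: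
  assumes "\<And>k. k \<in> {1..l} \<Longrightarrow> simple_root e l k \<bullet> v = 0"
  shows "v = 0"
proof -
  have step: "e k \<bullet> v = e (k + 1) \<bullet> v" if "1 \<le> k" "k < l" for k
    using assms[of k] that by (simp add: simple_root_less inner_diff_left)
  have "e (l - 1) \<bullet> v + e l \<bullet> v = 0"
    using assms[of l] rank by (simp add: simple_root_last inner_left_distrib)
  then have last: "e l \<bullet> v = 0" using step[of "l - 1"] rank by simp
  have "e k \<bullet> v = 0" if "k \<le> l" "1 \<le> k" for k
    using that by (induction k rule: inc_induct) (auto simp: last step)
  then have "(\<lambda>x. (x \<bullet> v) *\<^sub>R v) = (\<lambda>x. 0)"
    by (intro spanning) (auto intro!: linearI simp: inner_left_distrib scaleR_add_left)
  then have "(v \<bullet> v) *\<^sub>R v = 0" by meson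
  then show ?thesis by simp
qed

end

section \<open>The longest elements, \<open>\<omega>\<close> and the roots of mean zero\<close>

lemma weyl_length_eq: "weyl_length e l = word_length (simple_root e l ` {1..l})"
  by (simp add: fun_eq_iff weyl_length_def word_length_def)

text \<open>
  The choice of sign makes the simple roots other than \<open>\<alpha> j\<close> the differences of consecutive vectors of the
  frame, for both \<open>j = l - 1\<close> and \<open>j = l\<close>.
\<close>

definition adapted_frame :: "(nat \<Rightarrow> real ^ 'n) \<Rightarrow> nat \<Rightarrow> nat \<Rightarrow> nat \<Rightarrow> real ^ 'n" where
  "adapted_frame e l j k = (if k = l \<and> j \<noteq> l then - e k else e k)"

locale spin_node = orthonormal_frame e l for e :: "nat \<Rightarrow> real ^ 'n" and l +
  fixes j :: nat
  assumes even_rank: "even l"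
    and node: "j \<in> {l - 1, l}"
begin

abbreviation f :: "nat \<Rightarrow> real ^ 'n" where "f \<equiv> adapted_frame e l j"

lemma f_orthonormal:
  "p \<in> {1..l} \<Longrightarrow> q \<in> {1..l} \<Longrightarrow> f p \<bullet> f q = (if p = q then 1 else 0)"
  by (auto simp: adapted_frame_def orthonormal)

lemma f_spanning:
  fixes g h :: "real ^ 'n \<Rightarrow> real ^ 'n"
  assumes "linear g" "linear h" "\<And>k. k \<in> {1..l} \<Longrightarrow> g (f k) = h (f k)"
  shows "g = h"
proof (rule spanning[OF assms(1,2)])
  fix k assume "k \<in> {1..l}"
  then have "g (f k) = h (f k)" by (rule assms(3))
  then show "g (e k) = h (e k)"
    by (simp add: adapted_frame_def linear_neg[OF assms(1)] linear_neg[OF assms(2)] split: if_splits)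
qed

sublocale f: orthonormal_frame f l
  by standard (fact rank f_orthonormal f_spanning)+

lemma signed_axes_f: "signed_axes f l = signed_axes e l"
proof -
  have "x \<in> signed_axes f l" if "x \<in> signed_axes e l" for x
  proof -
    obtain s k where "x = s *\<^sub>R e k" "s \<in> {1, - 1}" "k \<in> {1..l}"
      using \<open>x \<in> signed_axes e l\<close> unfolding signed_axes_def by blast
    then show ?thesis
      using f.axisI[of s k] f.axisI[of "- s" k] by (auto simp: adapted_frame_def split: if_splits)
  qed
  moreover have "x \<in> signed_axes e l" if "x \<in> signed_axes f l" for x
  proof -
    obtain s k where "x = s *\<^sub>R f k" "s \<in> {1, - 1}" "k \<in> {1..l}"
      using \<open>x \<in> signed_axes f l\<close> unfolding signed_axes_def by blast
    then show ?thesis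
      using axisI[of s k] axisI[of "- s" k] by (auto simp: adapted_frame_def split: if_splits)
  qed
  ultimately show ?thesis by blast
qed

lemma roots_f: "roots f l = roots e l"
  unfolding roots_eq f.roots_eq signed_axes_f ..

lemma f_height: "k \<in> {1..l} \<Longrightarrow> f k \<bullet> height_vector e l = real (l - k)"
  by (auto simp: adapted_frame_def frame_height)

lemma simple_root_f:
  assumes "k \<in> {1..l}"
  shows "simple_root e l k = (if k = j then f (l - 1) + f l else if l - 1 \<le> k then f (l - 1) - f l
    else f k - f (k + 1))"
proof -
  consider "k < l - 1" | "k = l - 1" | "k = l" using assms by fastforce
  then show ?thesis
    by cases (use assms node rank in \<open>auto simp: simple_root_def adapted_frame_def\<close>)
qed

text \<open>
  A word in commuting reflections whose product is \<open>f k \<mapsto> s f (l + 1 - k)\<close>. With \<open>s = 1\<close> it is \<open>w\<^sub>j\<close>, with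
  \<open>s = - 1\<close> it is \<open>\<omega>\<close>, and the product of the two is \<open>- id = w\<^sub>0\<close>.
\<close>

definition mirror_word :: "real \<Rightarrow> (real ^ 'n) list" where
  "mirror_word s = map (\<lambda>i. f i - s *\<^sub>R f (Suc l - i)) [1..<Suc (l div 2)]"

lemma mirror_word_frame:
  assumes s: "s \<in> {1, - 1}" and k: "k \<in> {1..l}"
  shows "refl_word (mirror_word s) (f k) = s *\<^sub>R f (Suc l - k)"
proof -
  define w where "w m = refl_word (map (\<lambda>i. f i - s *\<^sub>R f (Suc l - i)) [1..<Suc m])" for m
  \<comment> \<open>After \<open>m\<close> letters exactly the outer \<open>m\<close> pairs of indices have been interchanged.\<close>
  have "w m (f k) = (if k \<le> m \<or> Suc l - k \<le> m then s *\<^sub>R f (Suc l - k) else f k)"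
    if "m \<le> l div 2" "k \<in> {1..l}" for m k
    using that
  proof (induction m arbitrary: k)
    case 0
    then show ?case by (auto simp: w_def)
  next
    case (Suc m)
    define q where "q = l - m"
    have q: "q \<in> {1..l}" "Suc m \<in> {1..l}" "q \<noteq> Suc m" "\<not> q \<le> m" "Suc l - q = Suc m" "Suc l - Suc m = q"
      using Suc.prems by (auto simp: q_def)
    let ?a = "f (Suc m) - s *\<^sub>R f q"
    have step: "w (Suc m) x = w m (reflection ?a x)" for x
      using q by (simp add: w_def refl_word_append q_def)
    have "?a \<bullet> ?a = 2"
      using s q by (auto simp: inner_diff_left inner_diff_right f_orthonormal)
    then have refl: "reflection ?a x = x - (x \<bullet> ?a) *\<^sub>R ?a" for x
      by (simp add: reflection_def)
    have lin: "w m (s *\<^sub>R x) = s *\<^sub>R w m x" for x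
      unfolding w_def using refl_word_linear linear_scale by blast
    consider "k = Suc m" | "k = q" | "k \<noteq> Suc m" "k \<noteq> q" by blast
    then show ?case
    proof cases
      case 1
      have "reflection ?a (f k) = s *\<^sub>R f q"
        using 1 q by (simp add: refl inner_diff_right f_orthonormal)
      then show ?thesis using 1 q Suc.IH[of q] Suc.prems by (simp add: step lin)
    next
      case 2
      have "reflection ?a (f k) = s *\<^sub>R f (Suc m)"
        using 2 q s by (auto simp: refl inner_diff_right f_orthonormal)
      then show ?thesis using 2 q Suc.IH[of "Suc m"] Suc.prems by (simp add: step lin)
    next
      case 3
      have "reflection ?a (f k) = f k"
        using 3 q Suc.prems by (simp add: refl inner_diff_right f_orthonormal)
      moreover have "Suc l - k \<noteq> Suc m" using 3 q Suc.prems by (auto simp: q_def)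
      ultimately show ?thesis using 3 Suc.IH[of k] Suc.prems by (simp add: step le_Suc_eq)
    qed
  qed
  from this[of "l div 2" k] show ?thesis
    using k even_rank by (auto simp: w_def mirror_word_def)
qed

lemma mirror_word_roots:
  assumes "s \<in> {1, - 1}"
  shows "set (mirror_word s) \<subseteq> roots e l"
proof
  fix a assume "a \<in> set (mirror_word s)"
  then obtain i where i: "a = f i - s *\<^sub>R f (Suc l - i)" "1 \<le> i" "i \<le> l div 2"
    unfolding mirror_word_def by fastforce
  then have "1 *\<^sub>R f i + (- s) *\<^sub>R f (Suc l - i) \<in> roots f l"
    using assms by (intro f.rootsI) auto
  then show "a \<in> roots e l" using i by (simp add: roots_f)
qed

lemma uminus_word: "refl_word (mirror_word 1) \<circ> refl_word (mirror_word (- 1)) = uminus"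
proof (rule f_spanning)
  show "linear (refl_word (mirror_word 1) \<circ> refl_word (mirror_word (- 1)))"
    by (intro linear_compose refl_word_linear)
  show "linear (uminus :: real ^ 'n \<Rightarrow> real ^ 'n)" by (simp add: linear_iff)
  fix k assume k: "k \<in> {1..l}"
  then have "Suc l - k \<in> {1..l}" by auto
  with k show "(refl_word (mirror_word 1) \<circ> refl_word (mirror_word (- 1))) (f k) = - f k"
    using mirror_word_frame[of "- 1" k] mirror_word_frame[of 1 "Suc l - k"]
    by (simp add: linear_neg[OF refl_word_linear])
qed

lemma longest_element_weyl: "longest_element e l (refl_group (roots e l)) = uminus"
proof -
  have "uminus \<in> refl_group (roots e l)"
    unfolding uminus_word[symmetric] using mirror_word_roots[of 1] mirror_word_roots[of "- 1"]
    by (intro refl_group_comp) (auto simp: refl_group_def)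
  moreover have "refl_group (roots e l) = refl_group (simple_root e l ` {1..l})"
    using refl_group_orthogonal_roots[of 0] by simp
  ultimately show ?thesis
    using longest_element_eq[of 0 uminus] by (simp add: longest_element_def weyl_length_eq)
qed

text \<open>
  Twice the fundamental coweight of \<open>j\<close>. It vanishes on all simple roots except \<open>\<alpha> j\<close>, so it cuts out the
  parabolic subsystem of \<open>w\<^sub>j\<close>, which consists of the roots \<open>\<plusminus>(f p - f q)\<close>.
\<close>

definition frame_sum :: "real ^ 'n" where "frame_sum = (\<Sum>k = 1..l. f k)"

lemma f_frame_sum: "k \<in> {1..l} \<Longrightarrow> f k \<bullet> frame_sum = 1"
  using f.inner_frame_sum[of k "\<lambda>_. 1"] by (simp add: frame_sum_def)

lemma simple_root_frame_sum: "k \<in> {1..l} \<Longrightarrow> simple_root e l k \<bullet> frame_sum = (if k = j then 2 else 0)"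
  using rank by (auto simp: simple_root_f inner_left_distrib inner_diff_left f_frame_sum)

text \<open>
  A positive root of the parabolic subsystem is \<open>f p - f q\<close> with \<open>p < q\<close>, and reversing the order of the
  indices makes it negative.
\<close>

lemma longest_element_parabolic:
  "longest_element e l (refl_group (simple_root e l ` ({1..l} - {j}))) = refl_word (mirror_word 1)"
proof -
  let ?D = "simple_root e l ` {1..l}"
  let ?w = "refl_word (mirror_word 1)"
  have J: "simple_root e l ` ({1..l} - {j}) = {\<alpha> \<in> ?D. \<alpha> \<bullet> frame_sum = 0}"
    using simple_root_frame_sum by (auto split: if_splits)
  have dominant: "0 \<le> \<alpha> \<bullet> frame_sum" if "\<alpha> \<in> ?D" for \<alpha>
    using that simple_root_frame_sum by auto
  have "a \<bullet> frame_sum = 0" if a: "a \<in> set (mirror_word 1)" for a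
  proof -
    obtain i where "a = f i - f (Suc l - i)" "1 \<le> i" "i \<le> l div 2"
      using a unfolding mirror_word_def by fastforce
    then have "a = f i - f (Suc l - i)" "i \<in> {1..l}" "Suc l - i \<in> {1..l}" by auto
    then show ?thesis by (simp add: inner_diff_left f_frame_sum)
  qed
  then have "?w \<in> refl_group {\<beta> \<in> roots e l. \<beta> \<bullet> frame_sum = 0}"
    using mirror_word_roots[of 1] unfolding refl_group_def by blast
  then have w: "?w \<in> refl_group {\<alpha> \<in> ?D. \<alpha> \<bullet> frame_sum = 0}"
    using refl_group_orthogonal_roots[OF dominant] by simp
  have neg: "?w \<beta> \<bullet> height_vector e l < 0"
    if \<beta>: "\<beta> \<in> roots e l" "0 < \<beta> \<bullet> height_vector e l" "\<beta> \<bullet> frame_sum = 0" for \<beta>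
  proof -
    have "\<beta> \<in> roots f l" using \<beta> roots_f by simp
    then obtain s t p q where st: "\<beta> = s *\<^sub>R f p + t *\<^sub>R f q" "s \<in> {1, - 1}" "t \<in> {1, - 1}"
      "1 \<le> p" "p < q" "q \<le> l"
      by (rule f.rootE)
    then have "t = - s"
      using \<beta>(3) by (simp add: inner_left_distrib f_frame_sum)
    moreover have "0 < s * (real (l - p) - real (l - q))"
      using \<beta>(2) st \<open>t = - s\<close> by (simp add: inner_left_distrib inner_diff_left f_height algebra_simps)
    ultimately have "\<beta> = f p - f q" using st by auto
    then have "?w \<beta> = f (Suc l - p) - f (Suc l - q)"
      using st mirror_word_frame[of 1 p] mirror_word_frame[of 1 q]
      by (simp add: linear_diff[OF refl_word_linear])
    moreover have "Suc l - p \<in> {1..l}" "Suc l - q \<in> {1..l}" "Suc l - q < Suc l - p" using st by auto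
    ultimately show ?thesis by (simp add: inner_diff_left f_height del: of_nat_diff)
  qed
  show ?thesis
    unfolding longest_element_def weyl_length_eq J by (rule longest_element_eq[OF dominant w neg])
qed

abbreviation \<omega> :: "real ^ 'n \<Rightarrow> real ^ 'n" where "\<omega> \<equiv> omega e l j"

lemma omega_eq: "\<omega> = refl_word (mirror_word 1) \<circ> uminus"
  unfolding omega_def longest_element_weyl longest_element_parabolic ..

lemma omega_linear: "linear \<omega>"
  unfolding omega_eq by (intro linear_compose refl_word_linear) (simp add: linear_iff)

lemma omega_frame: "k \<in> {1..l} \<Longrightarrow> \<omega> (f k) = - f (Suc l - k)"
  using mirror_word_frame[of 1 k] by (simp add: omega_eq linear_neg[OF refl_word_linear])

lemma omega_involution: "\<omega> \<circ> \<omega> = id"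
proof (rule f_spanning)
  show "linear (\<omega> \<circ> \<omega>)" by (intro linear_compose omega_linear)
  fix k assume k: "k \<in> {1..l}"
  then have "Suc l - k \<in> {1..l}" by auto
  with k show "(\<omega> \<circ> \<omega>) (f k) = id (f k)"
    using omega_frame[of k] omega_frame[of "Suc l - k"] by (simp add: linear_neg[OF omega_linear])
qed (rule linear_id)

lemma map_order_omega: "map_order \<omega> = 2"
  unfolding map_order_def
proof (rule Least_equality)
  show "0 < (2 :: nat) \<and> \<omega> ^^ 2 = id"
    using omega_involution by (simp add: numeral_2_eq_2)
next
  fix k assume k: "0 < k \<and> \<omega> ^^ k = id"
  have "\<omega> (f 1) \<bullet> f 1 = 0" "f 1 \<bullet> f 1 = 1"
    using rank omega_frame[of 1] by (simp_all add: f_orthonormal)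
  then have "\<omega> \<noteq> id" by auto
  then have "k \<noteq> 1" using k by auto
  then show "2 \<le> k" using k by linarith
qed

lemma orbit_mean_zero_iff: "orbit_mean \<omega> x = 0 \<longleftrightarrow> \<omega> x = - x"
proof -
  have "(\<omega> ^^ 2) x = x" using fun_cong[OF omega_involution, of x] by (simp add: numeral_2_eq_2)
  then have "orbit_mean \<omega> x = (1 / 2) *\<^sub>R (\<omega> x + x)"
    by (simp add: orbit_mean_def map_order_omega numeral_2_eq_2)
  then show ?thesis by (simp add: eq_neg_iff_add_eq_0)
qed

text \<open>
  If \<open>s f p + t f q\<close> with \<open>p < q\<close> is negated by \<open>\<omega>\<close>, it equals \<open>s f (l + 1 - p) + t f (l + 1 - q)\<close>. As \<open>l\<close> is even,
  \<open>p \<noteq> l + 1 - p\<close>, so comparing the coefficients of \<open>f p\<close> gives \<open>p = l + 1 - q\<close> and \<open>s = t\<close>.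
\<close>

lemma mean_zero_roots:
  "{\<beta> \<in> roots e l. orbit_mean \<omega> \<beta> = 0} =
    {s *\<^sub>R (f i + f (Suc l - i)) | s i. s \<in> {1, - 1} \<and> i \<in> {1..l div 2}}" (is "?L = ?R")
proof (intro equalityI subsetI)
  fix \<beta> assume "\<beta> \<in> ?L"
  then have \<beta>: "\<beta> \<in> roots f l" "\<omega> \<beta> = - \<beta>" by (auto simp: roots_f orbit_mean_zero_iff)
  from \<beta>(1) obtain s t p q where st: "\<beta> = s *\<^sub>R f p + t *\<^sub>R f q" "s \<in> {1, - 1}" "t \<in> {1, - 1}"
    "1 \<le> p" "p < q" "q \<le> l"
    by (rule f.rootE)
  have "\<omega> \<beta> = - (s *\<^sub>R f (Suc l - p) + t *\<^sub>R f (Suc l - q))"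
    using st omega_frame[of p] omega_frame[of q]
    by (simp add: linear_add[OF omega_linear] linear_scale[OF omega_linear])
  then have "\<beta> = s *\<^sub>R f (Suc l - p) + t *\<^sub>R f (Suc l - q)"
    using \<beta>(2) by (metis neg_equal_iff_equal)
  then have eq: "f p \<bullet> (s *\<^sub>R f p + t *\<^sub>R f q) = f p \<bullet> (s *\<^sub>R f (Suc l - p) + t *\<^sub>R f (Suc l - q))"
    using st(1) by simp
  have "s = s * (if p = Suc l - p then 1 else 0) + t * (if p = Suc l - q then 1 else 0)"
  proof -
    have "p \<in> {1..l}" "q \<in> {1..l}" "Suc l - p \<in> {1..l}" "Suc l - q \<in> {1..l}" "p \<noteq> q" using st by auto
    then show ?thesis using eq by (simp add: inner_right_distrib f_orthonormal)
  qed
  moreover have "p \<noteq> Suc l - p" using even_rank st by presburger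
  ultimately have "p = Suc l - q" "s = t" using st by (auto split: if_splits)
  then have "\<beta> = s *\<^sub>R (f p + f (Suc l - p))" "p \<in> {1..l div 2}"
    using st by (auto simp: scaleR_add_right)
  then show "\<beta> \<in> ?R" using st(2) by blast
next
  fix \<beta> assume "\<beta> \<in> ?R"
  then obtain s i where \<beta>: "\<beta> = s *\<^sub>R (f i + f (Suc l - i))" "s \<in> {1, - 1}" "i \<in> {1..l div 2}" by blast
  then have "s *\<^sub>R f i + s *\<^sub>R f (Suc l - i) \<in> roots f l" by (intro f.rootsI) auto
  then have "\<beta> \<in> roots e l" using \<beta> by (simp add: roots_f scaleR_add_right)
  moreover have "i \<in> {1..l}" "Suc l - i \<in> {1..l}" using \<beta>(3) by auto
  then have "\<omega> \<beta> = - \<beta>"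
    using \<beta>(1,2) omega_frame[of i] omega_frame[of "Suc l - i"]
    by (auto simp: linear_add[OF omega_linear] linear_diff[OF omega_linear] linear_neg[OF omega_linear])
  ultimately show "\<beta> \<in> ?L" by (simp add: orbit_mean_zero_iff)
qed

lemma pos_roots_mean_zero_eq:
  "pos_roots_mean_zero e l j = (\<lambda>i. f i + f (Suc l - i)) ` {1..l div 2}"
proof -
  have height: "0 < (f i + f (Suc l - i)) \<bullet> height_vector e l" if "i \<in> {1..l div 2}" for i
  proof -
    have "i \<in> {1..l}" "Suc l - i \<in> {1..l}" "i < l" using that rank by auto
    then show ?thesis by (simp add: inner_left_distrib f_height)
  qed
  have "pos_roots_mean_zero e l j =
      {\<beta> \<in> {\<beta> \<in> roots e l. orbit_mean \<omega> \<beta> = 0}. 0 < \<beta> \<bullet> height_vector e l}"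
    by (auto simp: pos_roots_mean_zero_def pos_roots_eq)
  also have "\<dots> = (\<lambda>i. f i + f (Suc l - i)) ` {1..l div 2}"
    unfolding mean_zero_roots
  proof (intro equalityI subsetI)
    fix \<beta> assume "\<beta> \<in> {\<beta> \<in> {s *\<^sub>R (f i + f (Suc l - i)) | s i. s \<in> {1, - 1} \<and> i \<in> {1..l div 2}}.
      0 < \<beta> \<bullet> height_vector e l}"
    then obtain s i where \<beta>: "\<beta> = s *\<^sub>R (f i + f (Suc l - i))" "s \<in> {1, - 1}" "i \<in> {1..l div 2}"
      "0 < \<beta> \<bullet> height_vector e l" by blast
    then have "s = 1" using height[of i] by (auto simp: inner_diff_left inner_left_distrib)
    then show "\<beta> \<in> (\<lambda>i. f i + f (Suc l - i)) ` {1..l div 2}" using \<beta> by simp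
  next
    fix \<beta> assume "\<beta> \<in> (\<lambda>i. f i + f (Suc l - i)) ` {1..l div 2}"
    then obtain i where "\<beta> = 1 *\<^sub>R (f i + f (Suc l - i))" "i \<in> {1..l div 2}" by auto
    then show "\<beta> \<in> {\<beta> \<in> {s *\<^sub>R (f i + f (Suc l - i)) | s i. s \<in> {1, - 1} \<and> i \<in> {1..l div 2}}.
      0 < \<beta> \<bullet> height_vector e l}"
      using height[of i] by force
  qed
  finally show ?thesis .
qed

section \<open>The orbit of the affine node\<close>

lemma sigma_orbit: "{(sigma e l j ^^ t) 0 | t. True} = {0, j}"
proof -
  have j: "1 \<le> j" "j \<le> l" using node rank by auto
  have aff: "affine_root e l 0 = - (f 1 + f 2)" "affine_root e l j = f (l - 1) + f l"
    using rank j by (simp_all add: affine_root_def highest_root_eq simple_root_f)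
      (simp_all add: adapted_frame_def)
  have "\<omega> (affine_root e l 0) = affine_root e l j"
    unfolding aff using rank omega_frame[of 1] omega_frame[of 2]
    by (simp add: linear_neg[OF omega_linear] linear_add[OF omega_linear] linear_diff[OF omega_linear])
  moreover from this have "\<omega> (affine_root e l j) = affine_root e l 0"
    using fun_cong[OF omega_involution, of "affine_root e l 0"] by simp
  moreover have the: "(THE k. k \<le> l \<and> affine_root e l m = affine_root e l k) = m" if "m \<le> l" for m
    using that affine_root_inj by blast
  ultimately have \<sigma>: "sigma e l j 0 = j" "sigma e l j j = 0"
    using j the[of 0] the[of j] by (simp_all add: sigma_def)
  have "(sigma e l j ^^ t) 0 = (if even t then 0 else j)" for t
    by (induction t) (auto simp: \<sigma>)
  then show ?thesis
    by (auto intro: exI[of _ "0 :: nat"] exI[of _ "1 :: nat"])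
qed

lemma pi_zero_eq: "pi_zero e l j = (1 / 2) *\<^sub>R frame_sum"
proof -
  let ?v = "(1 / 2) *\<^sub>R frame_sum"
  have j: "1 \<le> j" using node rank by auto
  have "(THE v. \<forall>k\<in>{1..l}. simple_root e l k \<bullet> v = (if k = j then 1 else 0)) = ?v"
  proof (rule the_equality)
    show v: "\<forall>k\<in>{1..l}. simple_root e l k \<bullet> ?v = (if k = j then 1 else 0)"
      by (simp add: simple_root_frame_sum)
    fix v assume "\<forall>k\<in>{1..l}. simple_root e l k \<bullet> v = (if k = j then 1 else 0)"
    with v have "v - ?v = 0"
      by (intro orthogonal_simple_roots_zero) (simp only: inner_diff_right)
    then show "v = ?v" by simp
  qed
  then have "fund_coweight e l j = ?v"
    using j unfolding fund_coweight_def by simp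
  then show ?thesis
    using j unfolding pi_zero_def sigma_orbit by (simp add: fund_coweight_def[of e l 0])
qed

lemma P_zero_eq: "P_zero e l j = {1, - 1}"
proof -
  have pair: "(s *\<^sub>R (f i + f (Suc l - i))) \<bullet> pi_zero e l j = s" if "i \<in> {1..l div 2}" for s i
  proof -
    have "i \<in> {1..l}" "Suc l - i \<in> {1..l}" using that by auto
    then show ?thesis by (simp add: pi_zero_eq inner_left_distrib f_frame_sum)
  qed
  show ?thesis
  proof (intro equalityI subsetI)
    fix x assume "x \<in> P_zero e l j"
    then obtain \<gamma> where \<gamma>: "\<gamma> \<in> {\<gamma> \<in> roots e l. orbit_mean \<omega> \<gamma> = 0}" "x = \<gamma> \<bullet> pi_zero e l j"
      unfolding P_zero_def by blast
    then obtain s i where "\<gamma> = s *\<^sub>R (f i + f (Suc l - i))" "s \<in> {1, - 1}" "i \<in> {1..l div 2}"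
      unfolding mean_zero_roots by blast
    then show "x \<in> {1, - 1}" using \<gamma>(2) pair[of i s] by (simp only:)
  next
    fix s :: real assume s: "s \<in> {1, - 1}"
    have 1: "1 \<in> {1..l div 2}" using rank by auto
    with s have "s *\<^sub>R (f 1 + f (Suc l - 1)) \<in> {\<gamma> \<in> roots e l. orbit_mean \<omega> \<gamma> = 0}"
      unfolding mean_zero_roots by blast
    then show "s \<in> P_zero e l j"
      unfolding P_zero_def mem_Collect_eq using pair[OF 1, of s]
      by (intro exI[of _ "s *\<^sub>R (f 1 + f (Suc l - 1))"]) (simp only: simp_thms)
  qed
qed

section \<open>Expansions in simple roots\<close>

lemma sum_simple_roots:
  assumes "p \<le> q + 1" "q < l"
  shows "(\<Sum>k = p..q. simple_root e l k) = e p - e (q + 1)"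
proof -
  have "(\<Sum>k = p..q. simple_root e l k) = (\<Sum>k = p..q. e k - e (k + 1))"
    by (rule sum.cong) (use assms in \<open>auto simp: simple_root_less\<close>)
  also have "\<dots> = e p - e (q + 1)"
    using assms(1) sum_natinterval_diff[of e p q] by (cases "p = q + 1") auto
  finally show ?thesis .
qed

text \<open>The case \<open>i = 1\<close> of the mean zero roots, the only one that depends on the node.\<close>

lemma first_expansion: "(\<Sum>k = 1..l - 2. simple_root e l k) + simple_root e l j = f 1 + f l"
proof -
  have "(\<Sum>k = 1..l - 2. simple_root e l k) = f 1 - f (l - 1)"
  proof -
    have "l - 2 + 1 = l - 1" "l - 1 \<noteq> l" using rank by simp_all
    then show ?thesis using rank sum_simple_roots[of 1 "l - 2"] by (simp add: adapted_frame_def)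
  qed
  then show ?thesis using simple_root_f[of j] node rank by auto
qed

lemma other_expansion:
  assumes "i \<in> {2..l div 2}"
  shows "(\<Sum>k = i..l - i. simple_root e l k) + (\<Sum>k = l - i + 1..l - 2. 2 *\<^sub>R simple_root e l k)
    + simple_root e l (l - 1) + simple_root e l l = e i + e (l - i + 1)"
proof -
  have "(\<Sum>k = i..l - i. simple_root e l k) = e i - e (l - i + 1)"
    using assms by (intro sum_simple_roots) auto
  moreover have "(\<Sum>k = l - i + 1..l - 2. 2 *\<^sub>R simple_root e l k) = 2 *\<^sub>R (e (l - i + 1) - e (l - 1))"
  proof -
    have "(\<Sum>k = l - i + 1..l - 2. simple_root e l k) = e (l - i + 1) - e (l - 2 + 1)"
      using assms by (intro sum_simple_roots) auto
    moreover have "l - 2 + 1 = l - 1" using rank by simp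
    ultimately show ?thesis by (simp only: scaleR_right.sum[symmetric])
  qed
  moreover have "simple_root e l (l - 1) = e (l - 1) - e l"
    using rank by (simp add: simple_root_less)
  ultimately show ?thesis by (simp add: simple_root_last scaleR_2)
qed

end

lemma orthonormal_frame_Basis:
  fixes e :: "nat \<Rightarrow> real ^ 'n"
  assumes "bij_betw e {1..l} Basis" "4 \<le> l"
  shows "orthonormal_frame e l"
proof
  show "e p \<bullet> e q = (if p = q then 1 else 0)" if "p \<in> {1..l}" "q \<in> {1..l}" for p q
  proof -
    have "e p \<in> Basis" "e q \<in> Basis" "e p = e q \<longleftrightarrow> p = q"
      using that assms(1) by (auto simp: bij_betw_def inj_on_eq_iff)
    then show ?thesis by (simp add: inner_Basis)
  qed
  show "g = h" if "linear g" "linear h" "\<And>k. k \<in> {1..l} \<Longrightarrow> g (e k) = h (e k)"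
    for g h :: "real ^ 'n \<Rightarrow> real ^ 'n"
  proof (rule linear_eq_stdbasis[OF that(1,2)])
    fix b :: "real ^ 'n" assume "b \<in> Basis"
    then obtain k where "k \<in> {1..l}" "b = e k" using assms(1) by (metis bij_betw_imp_surj_on imageE)
    then show "g b = h b" using that(3) by simp
  qed
qed (rule assms(2))

theorem proposition5p13:
  fixes e :: "nat \<Rightarrow> real ^ 'n" and l j :: nat
  assumes "l = CARD('n)" and "bij_betw e {1..l} Basis"
    and "4 \<le> l" and "even l" and "j \<in> {l - 1, l}"
  defines "\<alpha> \<equiv> simple_root e l"
  shows
    "(j = l - 1 \<longrightarrow>
        pos_roots_mean_zero e l j = {e 1 - e l} \<union> (\<lambda>i. e i + e (l - i + 1)) ` {2..l div 2} \<and>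
        {e 1 - e l} \<inter> (\<lambda>i. e i + e (l - i + 1)) ` {2..l div 2} = {}) \<and>
     (j = l \<longrightarrow>
        pos_roots_mean_zero e l j = (\<lambda>i. e i + e (l - i + 1)) ` {1..l div 2}) \<and>
     (let A = {(\<Sum>k = 1..l - 2. \<alpha> k) + \<alpha> j};
          B = (\<lambda>i. (\<Sum>k = i..l - i. \<alpha> k) + (\<Sum>k = l - i + 1..l - 2. 2 *\<^sub>R \<alpha> k)
                     + \<alpha> (l - 1) + \<alpha> l) ` {2..l div 2}
      in pos_roots_mean_zero e l j = A \<union> B \<and> A \<inter> B = {}) \<and>
     P_zero e l j = {1, - 1}"
proof -
  interpret spin_node e l j
    by (intro spin_node.intro spin_node_axioms.intro orthonormal_frame_Basis) (fact assms)+
  let ?B = "(\<lambda>i. e i + e (l - i + 1)) ` {2..l div 2}"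
  have inner_f: "f i + f (Suc l - i) = e i + e (l - i + 1)" if "i \<in> {2..l div 2}" for i
    using that rank by (auto simp: adapted_frame_def Suc_diff_le)
  have split: "{1..l div 2} = insert 1 {2..l div 2}" using rank by auto
  have mean_zero: "pos_roots_mean_zero e l j = {f 1 + f l} \<union> ?B"
  proof -
    have "(\<lambda>i. f i + f (Suc l - i)) ` {2..l div 2} = ?B"
      by (rule image_cong[OF refl inner_f])
    then show ?thesis unfolding pos_roots_mean_zero_eq split by simp
  qed
  have "(e i + e (l - i + 1)) \<bullet> e 1 = 0" if "i \<in> {2..l div 2}" for i
  proof -
    have "i \<in> {1..l}" "l - i + 1 \<in> {1..l}" "1 \<in> {1..l}" "i \<noteq> 1" "l - i + 1 \<noteq> 1"
      using that rank by auto
    then show ?thesis by (simp only: inner_left_distrib orthonormal) simp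
  qed
  moreover have "(f 1 + f l) \<bullet> e 1 = 1"
    using rank by (simp add: adapted_frame_def inner_left_distrib inner_diff_left orthonormal)
  ultimately have disjoint: "{f 1 + f l} \<inter> ?B = {}" by force
  have A: "{(\<Sum>k = 1..l - 2. \<alpha> k) + \<alpha> j} = {f 1 + f l}"
    unfolding \<alpha>_def first_expansion ..
  have B: "(\<lambda>i. (\<Sum>k = i..l - i. \<alpha> k) + (\<Sum>k = l - i + 1..l - 2. 2 *\<^sub>R \<alpha> k)
      + \<alpha> (l - 1) + \<alpha> l) ` {2..l div 2} = ?B"
    unfolding \<alpha>_def by (intro image_cong refl other_expansion)
  have f1: "f 1 + f l = (if j = l then e 1 + e l else e 1 - e l)"
    using rank by (simp add: adapted_frame_def)
  show ?thesis
  proof (intro conjI impI)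
    assume "j = l - 1"
    then have "f 1 + f l = e 1 - e l" using f1 rank by simp
    then show "pos_roots_mean_zero e l j = {e 1 - e l} \<union> ?B" "{e 1 - e l} \<inter> ?B = {}"
      using mean_zero disjoint by simp_all
  next
    assume "j = l"
    then show "pos_roots_mean_zero e l j = (\<lambda>i. e i + e (l - i + 1)) ` {1..l div 2}"
      unfolding mean_zero split using f1 rank by simp
  next
    show "let A = {(\<Sum>k = 1..l - 2. \<alpha> k) + \<alpha> j};
          B = (\<lambda>i. (\<Sum>k = i..l - i. \<alpha> k) + (\<Sum>k = l - i + 1..l - 2. 2 *\<^sub>R \<alpha> k)
                     + \<alpha> (l - 1) + \<alpha> l) ` {2..l div 2}
      in pos_roots_mean_zero e l j = A \<union> B \<and> A \<inter> B = {}"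
      unfolding A B Let_def using mean_zero disjoint by simp
  qed (rule P_zero_eq)
qed

end
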